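(* Consider the control-constrained $H_\infty$ problem, with $V_f$, $X_f$, $V_j^0$, $\kappa_j$, $X_j^\ast$, $\kappa_\infty$ as defined in the context. (i) The sets $X_j^\ast$ are each robust control invariant for $x^+=f(x,u,w)$ and are nondecreasing: $X_j^\ast\subseteq X_{j+1}^\ast$ for all $j\ge0$. (ii) For any $N\ge0$, the set $X_f$ is finite-time attractive with a domain of attraction $X_N^\ast$ for the closed-loop system $x^+=f(x,\kappa_\infty(x),w)$. (iii) Suppose that, for some finite integer $j\le N$, $X_f$ lies in the interior of $X_j^\ast$; then $X_f$ is robustly stable for the system $x^+=f(x,\kappa_\infty(x),w)$.
   Context: System: $x^+=f(x,u,w)=Ax+Bu+Gw$, $x\in\mathbb{R}^n$, $u\in\mathbb{R}^m$, $w\in\mathbb{R}^p$; constraints $u\in U$, $w\in W$, with $U,W$ polytopes containing the origin in their interiors, and no state constraint ($X=\mathbb{R}^n$). Stage cost $\ell(x,u,w)=\frac12x'Qx+\frac12u'Ru-\frac{\gamma^2}2|w|^2$, $Q,R$ positive definite, $f(x,u,W)=\{f(x,u,w)\mid w\in W\}$. Terminal cost and set: $(A,B)$ is stabilizable, and $(C,A,B)$ has no zeros on the unit circle, where $Q=C'C$. The number $\gamma$ is large enough that the $H_\infty$ algebraic Riccati equation of the unconstrained infinite horizon linear $H_\infty$ problem has a positive definite solution $P_f$, with associated optimal control and disturbance laws $u=K_ux$, $w=K_wx$ (so that, with $V_f(x)=\frac12x'P_fx$, $V_f(x)=\min_u\max_w\{\ell(x,u,w)+V_f(f(x,u,w))\}$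 over unconstrained $u,w$, attained at $K_ux,K_wx$), and $A_f=A+BK_u$ and $A_c=A+BK_u+GK_w$ are stable; in particular $V_f(A_cx)-V_f(x)+\ell(x,K_ux,K_wx)=0$. The set $X_f$ is a polytope containing the origin in its interior that is disturbance invariant for $x^+=A_fx+Gw$, i.e. $f(x,K_ux,W)\subseteq X_f$ for all $x\in X_f$, and satisfies $K_uX_f\subseteq U$ and $K_wX_f\subseteq W$ (and $X_f\subseteq X$); $W$ is assumed small enough and $\gamma$ large enough for such an $X_f$ to exist. Recursion: $V_0^0=V_f$, $X_0^\ast=X_f$ and for $j\ge1$ $$V_j^0(x)=\min_{u\in U}\max_{w\in W}\{\ell(x,u,w)+V_{j-1}^0(f(x,u,w))\},\quad \kappa_j(x)=\arg\min_{u\in U}\max_{w\in W}\{\ell(x,u,w)+V_{j-1}^0(f(x,u,w))\},$$ $$X_j^\ast=\{x\mid f(x,\kappa_j(x),W)\subseteq X_{j-1}^\ast\}.$$ $V_\infty^0$ and $\kappa_\infty$ denote the value function and optimal control law of the infinite horizon constrained problem $V_\infty^0(x)=\inf_\pi\max_{\mathbf{w}}\sum_{i=0}^\infty\ell(x_i,u_i,w_i)$ (over control policies with values in $U$ and disturbance sequences in $W$), so that $V^0_\infty(x)=\min_{u\in U}\max_{w\in W}\{\ell(x,u,w)+V_\infty^0(f(x,u,w))\}$ with minimizer $\kappa_\infty(x)$; these satisfy $V_\infty^0(x)=V_f(x)$, $\kappa_\infty(x)=K_ux$ on $X_f$, and $\kappa_0(x):=K_ux$ on $X_f$. A set $S$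 is robust control invariant for $x^+=f(x,u,w)$ if for every $x\in S$ there exists $u\in U$ with $f(x,u,W)\subseteq S$. "$X_f$ is finite-time attractive with a domain of attraction $X_N^\ast$" means: from every initial state in $X_N^\ast$, for every disturbance sequence in $W$, the state enters $X_f$ in at most $N$ steps and remains there thereafter. "$X_f$ is robustly stable" means: for every $\varepsilon>0$ there exists $\delta>0$ such that if $d(x(0),X_f)<\delta$ then $d(x(i),X_f)<\varepsilon$ for all $i\ge0$ and every disturbance sequence in $W$, where $x(i)$ is the solution of the closed-loop system and $d$ the Euclidean distance. *)

theory Defs
  imports "HOL-Analysis.Analysis"
begin

section \<open>Matrices and linear systems\<close>

definition pos_def :: "real^'n^'n \<Rightarrow> bool" where
  "pos_def M \<longleftrightarrow> transpose M = M \<and> (\<forall>x. x \<noteq> 0 \<longrightarrow> x \<bullet> (M *v x) > 0)"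

definition cmatrix :: "real^'n^'m \<Rightarrow> complex^'n^'m" where
  "cmatrix M = (\<chi> i j. complex_of_real (M $ i $ j))"

text \<open>Stability is meant in discrete time: all complex eigenvalues lie in the open unit disc.\<close>

definition stable_matrix :: "real^'n^'n \<Rightarrow> bool" where
  "stable_matrix M \<longleftrightarrow>
     (\<forall>z v. v \<noteq> 0 \<and> cmatrix M *v v = z *s v \<longrightarrow> cmod z < 1)"

definition stabilizable :: "real^'n^'n \<Rightarrow> real^'m^'n \<Rightarrow> bool" where
  "stabilizable A B \<longleftrightarrow> (\<exists>K. stable_matrix (A + B ** K))"

text \<open>The Rosenbrock system matrix, with block rows (A - zI, B) and (C, 0).\<close>

definition system_matrix ::
  "real^'n^'q \<Rightarrow> real^'n^'n \<Rightarrow> real^'m^'n \<Rightarrow> complex \<Rightarrow> complex^('n + 'm)^('n + 'q)" where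
  "system_matrix C A B z = (\<chi> i j.
     (case i of
        Inl a \<Rightarrow> (case j of
            Inl b \<Rightarrow> complex_of_real (A $ a $ b) - (if a = b then z else 0)
          | Inr b \<Rightarrow> complex_of_real (B $ a $ b))
      | Inr c \<Rightarrow> (case j of
            Inl b \<Rightarrow> complex_of_real (C $ c $ b)
          | Inr b \<Rightarrow> 0)))"

text \<open>A zero of the system is a point at which the system matrix drops below its normal rank,
  the normal rank being the maximal rank over the complex plane.\<close>

definition system_zero ::
  "real^'n^'q \<Rightarrow> real^'n^'n \<Rightarrow> real^'m^'n \<Rightarrow> complex \<Rightarrow> bool" where
  "system_zero C A B z \<longleftrightarrow>
     (\<exists>s. rank (system_matrix C A B z) < rank (system_matrix C A B s))"

definition linear_plant ::
  "real^'n^'n \<Rightarrow> real^'m^'n \<Rightarrow> real^'p^'n \<Rightarrow> real^'n \<Rightarrow> real^'m \<Rightarrow> real^'p \<Rightarrow> real^'n" where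
  "linear_plant A B G x u w = A *v x + B *v u + G *v w"

definition stage_cost ::
  "real^'n^'n \<Rightarrow> real^'m^'m \<Rightarrow> real \<Rightarrow> real^'n \<Rightarrow> real^'m \<Rightarrow> real^'p \<Rightarrow> real" where
  "stage_cost Q R \<gamma> x u w =
     1/2 * (x \<bullet> (Q *v x)) + 1/2 * (u \<bullet> (R *v u)) - \<gamma>\<^sup>2 / 2 * (norm w)\<^sup>2"


section \<open>The $H_\infty$ algebraic Riccati equation\<close>

text \<open>Write M for \<open>riccati_inner G \<gamma> P\<close>.  For y = Ax + Bu, if \<open>\<gamma>\<^sup>2I - G'PG\<close> is positive definite,
  the maximum over w of \<open>-(\<gamma>\<^sup>2/2)|w|\<^sup>2 + (1/2)(y + Gw)'P(y + Gw)\<close> equals \<open>(1/2) y'My\<close>, attained at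
  \<open>w = (\<gamma>\<^sup>2I - G'PG)\<^sup>-\<^sup>1 G'Py\<close>.  What remains is the minimisation over u of a linear-quadratic
  cost with M in place of P, which gives the equation and the gains below.\<close>

definition riccati_inner :: "real^'p^'n \<Rightarrow> real \<Rightarrow> real^'n^'n \<Rightarrow> real^'n^'n" where
  "riccati_inner G \<gamma> P =
     P + P ** G ** matrix_inv (mat (\<gamma>\<^sup>2) - transpose G ** P ** G) ** transpose G ** P"

definition hinf_riccati ::
  "real^'n^'n \<Rightarrow> real^'m^'n \<Rightarrow> real^'p^'n \<Rightarrow> real^'n^'n \<Rightarrow> real^'m^'m \<Rightarrow> real \<Rightarrow> real^'n^'n \<Rightarrow> bool"
  where
  "hinf_riccati A B G Q R \<gamma> P \<longleftrightarrow>
     pos_def (mat (\<gamma>\<^sup>2) - transpose G ** P ** G) \<and>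
     (let M = riccati_inner G \<gamma> P in
        P = Q + transpose A ** M ** A
            - transpose A ** M ** B ** matrix_inv (R + transpose B ** M ** B)
                ** transpose B ** M ** A)"

definition control_gain ::
  "real^'n^'n \<Rightarrow> real^'m^'n \<Rightarrow> real^'p^'n \<Rightarrow> real^'m^'m \<Rightarrow> real \<Rightarrow> real^'n^'n \<Rightarrow> real^'n^'m" where
  "control_gain A B G R \<gamma> P =
     (let M = riccati_inner G \<gamma> P in
        - (matrix_inv (R + transpose B ** M ** B) ** transpose B ** M ** A))"

definition disturbance_gain ::
  "real^'n^'n \<Rightarrow> real^'m^'n \<Rightarrow> real^'p^'n \<Rightarrow> real^'m^'m \<Rightarrow> real \<Rightarrow> real^'n^'n \<Rightarrow> real^'n^'p" where
  "disturbance_gain A B G R \<gamma> P =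
     matrix_inv (mat (\<gamma>\<^sup>2) - transpose G ** P ** G) ** transpose G ** P
       ** (A + B ** control_gain A B G R \<gamma> P)"


section \<open>The constrained dynamic game\<close>

text \<open>In the setting of interest all minima and maxima below are attained and the minimiser
  is unique (U and W are compact, the values are continuous and convex, and the cost is
  strictly convex in u), so Inf, Sup and the choice made by \<^const>\<open>arg_min_on\<close> are harmless.\<close>

primrec value_iter ::
  "('x \<Rightarrow> 'u \<Rightarrow> 'w \<Rightarrow> 'x) \<Rightarrow> ('x \<Rightarrow> 'u \<Rightarrow> 'w \<Rightarrow> real) \<Rightarrow> 'u set \<Rightarrow> 'w set \<Rightarrow> ('x \<Rightarrow> real)
     \<Rightarrow> nat \<Rightarrow> 'x \<Rightarrow> real" where
  "value_iter f l U W Vf 0 = Vf"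
| "value_iter f l U W Vf (Suc j) =
     (\<lambda>x. INF u\<in>U. SUP w\<in>W. l x u w + value_iter f l U W Vf j (f x u w))"

text \<open>\<open>control_law \<dots> j\<close> is the law \<open>\<kappa>\<^sub>j\<close>; it is meaningful for \<open>j \<ge> 1\<close> only.\<close>

definition control_law ::
  "('x \<Rightarrow> 'u \<Rightarrow> 'w \<Rightarrow> 'x) \<Rightarrow> ('x \<Rightarrow> 'u \<Rightarrow> 'w \<Rightarrow> real) \<Rightarrow> 'u set \<Rightarrow> 'w set \<Rightarrow> ('x \<Rightarrow> real)
     \<Rightarrow> nat \<Rightarrow> 'x \<Rightarrow> 'u" where
  "control_law f l U W Vf j x =
     arg_min_on (\<lambda>u. SUP w\<in>W. l x u w + value_iter f l U W Vf (j - 1) (f x u w)) U"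

primrec domain_set ::
  "('x \<Rightarrow> 'u \<Rightarrow> 'w \<Rightarrow> 'x) \<Rightarrow> ('x \<Rightarrow> 'u \<Rightarrow> 'w \<Rightarrow> real) \<Rightarrow> 'u set \<Rightarrow> 'w set \<Rightarrow> ('x \<Rightarrow> real)
     \<Rightarrow> 'x set \<Rightarrow> nat \<Rightarrow> 'x set" where
  "domain_set f l U W Vf Xf 0 = Xf"
| "domain_set f l U W Vf Xf (Suc j) =
     {x. f x (control_law f l U W Vf (Suc j) x) ` W \<subseteq> domain_set f l U W Vf Xf j}"

text \<open>A policy is a sequence of state feedback laws.\<close>

primrec trajectory ::
  "('x \<Rightarrow> 'u \<Rightarrow> 'w \<Rightarrow> 'x) \<Rightarrow> (nat \<Rightarrow> 'x \<Rightarrow> 'u) \<Rightarrow> (nat \<Rightarrow> 'w) \<Rightarrow> 'x \<Rightarrow> nat \<Rightarrow> 'x" where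
  "trajectory f \<pi> w x 0 = x"
| "trajectory f \<pi> w x (Suc i) =
     f (trajectory f \<pi> w x i) (\<pi> i (trajectory f \<pi> w x i)) (w i)"

text \<open>The stage cost has no fixed sign, so the partial sums need not converge; the infinite
  sum is read as their upper limit in the extended reals.\<close>

definition infinite_cost ::
  "('x \<Rightarrow> 'u \<Rightarrow> 'w \<Rightarrow> 'x) \<Rightarrow> ('x \<Rightarrow> 'u \<Rightarrow> 'w \<Rightarrow> real)
     \<Rightarrow> (nat \<Rightarrow> 'x \<Rightarrow> 'u) \<Rightarrow> (nat \<Rightarrow> 'w) \<Rightarrow> 'x \<Rightarrow> ereal" where
  "infinite_cost f l \<pi> w x =
     limsup (\<lambda>n. ereal (\<Sum>i<n. l (trajectory f \<pi> w x i) (\<pi> i (trajectory f \<pi> w x i)) (w i)))"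

definition worst_case_cost ::
  "('x \<Rightarrow> 'u \<Rightarrow> 'w \<Rightarrow> 'x) \<Rightarrow> ('x \<Rightarrow> 'u \<Rightarrow> 'w \<Rightarrow> real) \<Rightarrow> 'w set
     \<Rightarrow> (nat \<Rightarrow> 'x \<Rightarrow> 'u) \<Rightarrow> 'x \<Rightarrow> ereal" where
  "worst_case_cost f l W \<pi> x = (SUP w\<in>{w. \<forall>i. w i \<in> W}. infinite_cost f l \<pi> w x)"

definition infinite_value ::
  "('x \<Rightarrow> 'u \<Rightarrow> 'w \<Rightarrow> 'x) \<Rightarrow> ('x \<Rightarrow> 'u \<Rightarrow> 'w \<Rightarrow> real) \<Rightarrow> 'u set \<Rightarrow> 'w set \<Rightarrow> 'x \<Rightarrow> ereal" where
  "infinite_value f l U W x =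
     (INF \<pi>\<in>{\<pi>. \<forall>i y. \<pi> i y \<in> U}. worst_case_cost f l W \<pi> x)"

definition optimal_law ::
  "('x \<Rightarrow> 'u \<Rightarrow> 'w \<Rightarrow> 'x) \<Rightarrow> ('x \<Rightarrow> 'u \<Rightarrow> 'w \<Rightarrow> real) \<Rightarrow> 'u set \<Rightarrow> 'w set \<Rightarrow> ('x \<Rightarrow> 'u) \<Rightarrow> bool" where
  "optimal_law f l U W \<kappa> \<longleftrightarrow>
     (\<forall>x. \<kappa> x \<in> U) \<and>
     (\<forall>x. worst_case_cost f l W (\<lambda>_. \<kappa>) x = infinite_value f l U W x)"


section \<open>Invariance, attractivity and stability\<close>

definition robust_control_invariant ::
  "('x \<Rightarrow> 'u \<Rightarrow> 'w \<Rightarrow> 'x) \<Rightarrow> 'u set \<Rightarrow> 'w set \<Rightarrow> 'x set \<Rightarrow> bool" where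
  "robust_control_invariant f U W S \<longleftrightarrow> (\<forall>x\<in>S. \<exists>u\<in>U. f x u ` W \<subseteq> S)"

definition finite_time_attractive ::
  "('x \<Rightarrow> 'u \<Rightarrow> 'w \<Rightarrow> 'x) \<Rightarrow> ('x \<Rightarrow> 'u) \<Rightarrow> 'w set \<Rightarrow> 'x set \<Rightarrow> nat \<Rightarrow> 'x set \<Rightarrow> bool" where
  "finite_time_attractive f \<kappa> W S N D \<longleftrightarrow>
     (\<forall>x\<in>D. \<forall>w. (\<forall>i. w i \<in> W) \<longrightarrow>
        (\<exists>k\<le>N. \<forall>i\<ge>k. trajectory f (\<lambda>_. \<kappa>) w x i \<in> S))"

definition robustly_stable ::
  "('x::metric_space \<Rightarrow> 'u \<Rightarrow> 'w \<Rightarrow> 'x) \<Rightarrow> ('x \<Rightarrow> 'u) \<Rightarrow> 'w set \<Rightarrow> 'x set \<Rightarrow> bool" where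
  "robustly_stable f \<kappa> W S \<longleftrightarrow>
     (\<forall>\<epsilon>>0. \<exists>\<delta>>0. \<forall>x. infdist x S < \<delta> \<longrightarrow>
        (\<forall>w. (\<forall>i. w i \<in> W) \<longrightarrow> (\<forall>i. infdist (trajectory f (\<lambda>_. \<kappa>) w x i) S < \<epsilon>)))"

end

theory Submission
  imports Defs "HOL-Computational_Algebra.Fundamental_Theorem_Algebra"
begin

text \<open>
Write \<open>V\<^sub>j\<close>, \<open>\<kappa>\<^sub>j\<close> and \<open>X\<^sub>j\<close> for the value iterates, their minimisers and the sets
\<open>domain_set\<close>, and J for the infinite-horizon value.  Everything follows from one fact: on \<open>X\<^sub>j\<close>
the laws \<open>\<kappa>\<^sub>j\<close>, \<open>\<kappa>\<^sub>j\<^sub>+\<^sub>1\<close> and \<open>\<kappa>_inf\<close> coincide for \<open>j \<ge> 1\<close>, and on \<open>Xf\<close> they equal the linear law \<open>Ku\<close>.  Granted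
this, monotonicity and robust control invariance of the \<open>X\<^sub>j\<close> are immediate inductions, and a closed
loop started in \<open>X\<^sub>N\<close> passes through \<open>X\<^sub>N\<^sub>-\<^sub>1\<close>, \<open>X\<^sub>N\<^sub>-\<^sub>2\<close>, ... and so reaches \<open>Xf\<close> within N steps.
For stability, near \<open>Xf\<close> the closed loop uses a single law \<open>\<kappa>\<^sub>j\<close>, which by compactness moves points
close to \<open>Xf\<close> to points close to \<open>Xf\<close>; only the finitely many steps before \<open>Xf\<close> is entered count.

The coincidence of the laws is a local-implies-global argument for convex functions.  It cannot be
read off from the equality of the values alone: a trajectory from \<open>X\<^sub>j\<close> may run along the boundary of
\<open>X\<^sub>j\<^sub>-\<^sub>1\<close>, and outside this set the values differ in an uncontrolled direction (the bound on the
control raises the cost, the bound on the disturbance lowers it).  What survives is one-sided: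
a function F, here \<open>V\<^sub>j\<^sub>+\<^sub>1\<close> or J, lies above every tangent of \<open>V\<^sub>j\<close> taken at a point of
\<open>X\<^sub>j\<close> (\<open>tangent_dominates\<close>).  This property is carried through one step of the
min-max recursion by a directional-derivative argument for a maximum over a compact set
(\<open>uniform_secant_bound\<close>, \<open>worst_secant\<close>), and the strong convexity of the stage cost in u then
forces the minimisers to agree (\<open>minimiser_agreement\<close>).  The induction is the same for the
finite and for the infinite horizon; only its base differs.

The base is the linear-quadratic theory.  The Riccati equation yields the costate relations
\<open>riccati_stationarity\<close>, hence an exact identity (\<open>riccati_saddle_control\<close>): against the disturbance
\<open>Kw x\<close>, any control at any state z incurs a stage cost which, added to the tangent of \<open>Vf\<close> at the saddle
successor of x, gives the tangent at x plus squares.  One step of it handles \<open>V\<^sub>1\<close>.  For J the disturbance is played open loop along the reference trajectory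
\<open>x, Ac x, Ac\<^sup>2 x, ...\<close>, which stays in \<open>Xf\<close> and is therefore admissible, and the remaining error
vanishes because \<open>Ac = A + B Ku + G Kw\<close> is stable (\<open>stable_powers_tendsto_0\<close>).  The opposite
inequality \<open>J \<le> Vf\<close> on \<open>Xf\<close> comes from playing \<open>Ku\<close>.
\<close>

section \<open>Worst-case costs in a convex dynamic game\<close>

text \<open>A substitute for Danskin's theorem on directional derivatives of a maximum, with no derivative in
it.  One strict secant bound per parameter value w suffices: by continuity it persists near w, by
convexity in t it is inherited by all smaller t, and finitely many such neighbourhoods cover W.\<close>

lemma uniform_secant_bound:
  fixes \<phi> :: "real \<Rightarrow> 'w::topological_space \<Rightarrow> real"
  assumes "compact W"
    and cont: "\<And>t. 0 \<le> t \<Longrightarrow> t \<le> 1 \<Longrightarrow> continuous_on W (\<phi> t)"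
    and conv: "\<And>w s t. w \<in> W \<Longrightarrow> 0 \<le> s \<Longrightarrow> s \<le> 1 \<Longrightarrow> 0 \<le> t \<Longrightarrow> t \<le> 1 \<Longrightarrow>
                 \<phi> (s * t) w \<le> (1 - s) * \<phi> 0 w + s * \<phi> t w"
    and le_H: "\<And>w. w \<in> W \<Longrightarrow> \<phi> 0 w \<le> H"
    and below: "\<And>w. w \<in> W \<Longrightarrow> \<exists>t. 0 < t \<and> t \<le> 1 \<and> \<phi> t w < (1 - t) * H + t * c"
  shows "\<forall>\<^sub>F t in at_right 0. \<forall>w\<in>W. \<phi> t w \<le> (1 - t) * H + t * c"
proof -
  have "\<forall>w\<in>W. \<exists>t. 0 < t \<and> t \<le> 1 \<and> \<phi> t w < (1 - t) * H + t * c"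
    using below by blast
  then obtain T where T: "\<And>w. w \<in> W \<Longrightarrow> 0 < T w \<and> T w \<le> 1 \<and> \<phi> (T w) w < (1 - T w) * H + T w * c"
    by metis
  have "\<exists>N. open N \<and> N \<inter> W = {v\<in>W. \<phi> (T w) v < (1 - T w) * H + T w * c}" if "w \<in> W" for w
  proof -
    have "continuous_on W (\<phi> (T w))" using cont T[OF that] by simp
    then have "\<exists>N. open N \<and> N \<inter> W = \<phi> (T w) -` {..<(1 - T w) * H + T w * c} \<inter> W"
      by (simp add: continuous_on_open_invariant)
    then show ?thesis by (auto simp: vimage_def Int_def conj_commute)
  qed
  then obtain N where N: "\<And>w. w \<in> W \<Longrightarrow> open (N w)"
      "\<And>w. w \<in> W \<Longrightarrow> N w \<inter> W = {v\<in>W. \<phi> (T w) v < (1 - T w) * H + T w * c}"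
    by metis
  have cover: "W \<subseteq> (\<Union>w\<in>W. N w)"
    using N(2) T by blast
  obtain D where D: "D \<subseteq> W" "finite D" "W \<subseteq> (\<Union>w\<in>D. N w)"
    using compactE_image[OF \<open>compact W\<close> _ cover] N(1) by metis
  define b where "b = Min (insert 1 (T ` D))"
  have b: "0 < b" "\<And>w. w \<in> D \<Longrightarrow> b \<le> T w"
    using D T by (auto simp: b_def)
  have "\<phi> t w \<le> (1 - t) * H + t * c" if t: "0 < t" "t < b" and w: "w \<in> W" for t w
  proof -
    obtain d where d: "d \<in> D" "w \<in> N d" using D w by blast
    have dW: "d \<in> W" using d D by blast
    define s where "s = t / T d"
    have Td: "0 < T d" "T d \<le> 1" "t < T d" using T[OF dW] b(2)[OF d(1)] t by auto
    have s: "0 \<le> s" "s \<le> 1" "s * T d = t" using Td t by (auto simp: s_def)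
    have "\<phi> (T d) w < (1 - T d) * H + T d * c" using N(2)[OF dW] d w by blast
    then have "s * \<phi> (T d) w \<le> s * ((1 - T d) * H + T d * c)"
      using s by (intro mult_left_mono) auto
    moreover have "(1 - s) * \<phi> 0 w \<le> (1 - s) * H"
      using s le_H[OF w] by (intro mult_left_mono) auto
    moreover have "\<phi> t w \<le> (1 - s) * \<phi> 0 w + s * \<phi> (T d) w"
      using conv[OF w s(1,2), of "T d"] Td s by simp
    moreover have "(1 - s) * H + s * ((1 - T d) * H + T d * c) = (1 - s * T d) * H + (s * T d) * c"
      by (simp add: algebra_simps)
    ultimately show ?thesis using s by simp
  qed
  then show ?thesis
    unfolding eventually_at_right_field using b(1) by blast
qed

text \<open>F lies above all tangents of V taken at points of S.  For convex V the secant bound for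
small t says that the directional derivative of V at x towards z is at most \<open>c - V x\<close> for
every upper bound c of \<open>F z\<close>.  Quantifying over c lets F be infinite, and the slack e is there
because the difference quotients need not attain their limit.\<close>

definition tangent_dominates ::
    "('x::real_normed_vector \<Rightarrow> ereal) \<Rightarrow> ('x \<Rightarrow> real) \<Rightarrow> 'x set \<Rightarrow> bool" where
  "tangent_dominates F V S \<longleftrightarrow>
     (\<forall>x\<in>S. \<forall>z c e. F z \<le> ereal c \<longrightarrow> 0 < e \<longrightarrow>
        (\<forall>\<^sub>F t in at_right 0. V (linepath x z t) \<le> (1 - t) * V x + t * (c + e)))"

text \<open>The features of the constrained linear-quadratic problem that the recursion uses: affine dynamics and
a stage cost that is jointly convex in state and control, with strong convexity modulus
\<open>\<rho>\<close> in the control.\<close>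

locale convex_game =
  fixes f :: "'x::euclidean_space \<Rightarrow> 'u::euclidean_space \<Rightarrow> 'w::euclidean_space \<Rightarrow> 'x"
    and l :: "'x \<Rightarrow> 'u \<Rightarrow> 'w \<Rightarrow> real"
    and U :: "'u set" and W :: "'w set" and \<rho> :: "'u \<Rightarrow> real"
  assumes f_linepath:
      "f (linepath x z t) (linepath u v t) w = linepath (f x u w) (f z v w) t"
    and continuous_f: "continuous_on UNIV (\<lambda>(x, u, w). f x u w)"
    and continuous_l: "continuous_on UNIV (\<lambda>(x, u, w). l x u w)"
    and l_strongly_convex: "0 \<le> t \<Longrightarrow> t \<le> 1 \<Longrightarrow>
      l (linepath x z t) (linepath u v t) w
        \<le> (1 - t) * l x u w + t * l z v w - t * (1 - t) * \<rho> (v - u)"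
    and \<rho>_nonneg: "0 \<le> \<rho> d"
    and \<rho>_zero: "\<rho> d \<le> 0 \<Longrightarrow> d = 0"
    and U: "compact U" "convex U" "U \<noteq> {}"
    and W: "compact W" "W \<noteq> {}"
begin

definition worst :: "('x \<Rightarrow> real) \<Rightarrow> 'x \<Rightarrow> 'u \<Rightarrow> real" where
  "worst V x u = (SUP w\<in>W. l x u w + V (f x u w))"

lemma continuous_on_f [continuous_intros]:
  assumes "continuous_on S a" "continuous_on S b" "continuous_on S c"
  shows "continuous_on S (\<lambda>y. f (a y) (b y) (c y))"
  using continuous_on_compose2[OF continuous_f, of S "\<lambda>y. (a y, b y, c y)"] assms
  by (simp add: continuous_on_Pair)

lemma continuous_on_l [continuous_intros]:
  assumes "continuous_on S a" "continuous_on S b" "continuous_on S c"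
  shows "continuous_on S (\<lambda>y. l (a y) (b y) (c y))"
  using continuous_on_compose2[OF continuous_l, of S "\<lambda>y. (a y, b y, c y)"] assms
  by (simp add: continuous_on_Pair)

lemma continuous_on_convex:
  fixes V :: "'a::euclidean_space \<Rightarrow> real"
  assumes "convex_on UNIV V" "continuous_on S a"
  shows "continuous_on S (\<lambda>y. V (a y))"
  using continuous_on_compose2[OF convex_on_continuous[OF open_UNIV assms(1)] assms(2)] by simp

lemma l_convex:
  assumes "0 \<le> t" "t \<le> 1"
  shows "l (linepath x z t) (linepath u v t) w \<le> (1 - t) * l x u w + t * l z v w"
proof -
  have "0 \<le> t * (1 - t) * \<rho> (v - u)" using assms \<rho>_nonneg by simp
  then show ?thesis using l_strongly_convex[OF assms, of x z u v w] by linarith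
qed

lemma convex_on_linepathD:
  "convex_on UNIV V \<Longrightarrow> 0 \<le> t \<Longrightarrow> t \<le> 1 \<Longrightarrow> V (linepath x z t) \<le> (1 - t) * V x + t * V z"
  unfolding linepath_def by (rule convex_onD) auto

lemma worst_upper:
  assumes "convex_on UNIV V" "w \<in> W"
  shows "l x u w + V (f x u w) \<le> worst V x u"
proof -
  have "continuous_on W (\<lambda>w. l x u w + V (f x u w))"
    by (intro continuous_intros continuous_on_convex[OF assms(1)])
  then have "bdd_above ((\<lambda>w. l x u w + V (f x u w)) ` W)"
    by (intro bounded_imp_bdd_above compact_imp_bounded compact_continuous_image W)
  then show ?thesis unfolding worst_def using assms(2) by (rule cSUP_upper[rotated])
qed

lemma worst_least: "(\<And>w. w \<in> W \<Longrightarrow> l x u w + V (f x u w) \<le> c) \<Longrightarrow> worst V x u \<le> c"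
  unfolding worst_def using W by (intro cSUP_least) auto

lemma worst_convex:
  assumes V: "convex_on UNIV V" and t: "0 \<le> t" "t \<le> 1"
  shows "worst V (linepath x z t) (linepath u v t) \<le> (1 - t) * worst V x u + t * worst V z v"
proof (rule worst_least)
  fix w assume w: "w \<in> W"
  have "l (linepath x z t) (linepath u v t) w + V (f (linepath x z t) (linepath u v t) w)
      \<le> ((1 - t) * l x u w + t * l z v w) + ((1 - t) * V (f x u w) + t * V (f z v w))"
    unfolding f_linepath using t by (intro add_mono l_convex convex_on_linepathD V)
  also have "\<dots> = (1 - t) * (l x u w + V (f x u w)) + t * (l z v w + V (f z v w))"
    by (simp add: algebra_simps)
  also have "\<dots> \<le> (1 - t) * worst V x u + t * worst V z v"
    using t by (intro add_mono mult_left_mono worst_upper V w) auto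
  finally show "l (linepath x z t) (linepath u v t) w
      + V (f (linepath x z t) (linepath u v t) w) \<le> (1 - t) * worst V x u + t * worst V z v" .
qed

lemma convex_on_worst:
  assumes "convex_on UNIV V"
  shows "convex_on UNIV (\<lambda>p. worst V (fst p) (snd p))"
proof (rule convex_onI)
  fix t :: real and p q :: "'x \<times> 'u"
  assume "0 < t" "t < 1"
  then show "worst V (fst ((1 - t) *\<^sub>R p + t *\<^sub>R q)) (snd ((1 - t) *\<^sub>R p + t *\<^sub>R q))
      \<le> (1 - t) * worst V (fst p) (snd p) + t * worst V (fst q) (snd q)"
    using worst_convex[OF assms, of t "fst p" "fst q" "snd p" "snd q"] by (simp add: linepath_def)
qed auto

lemma continuous_on_worst:
  assumes "convex_on UNIV V" "continuous_on S a" "continuous_on S b"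
  shows "continuous_on S (\<lambda>y. worst V (a y) (b y))"
  using continuous_on_convex[OF convex_on_worst[OF assms(1)], of S "\<lambda>y. (a y, b y)"] assms(2,3)
  by (simp add: continuous_on_Pair)

definition bellman :: "('x \<Rightarrow> real) \<Rightarrow> 'x \<Rightarrow> real" where
  "bellman V x = (INF u\<in>U. worst V x u)"

lemma bellman_attained:
  assumes V: "convex_on UNIV V"
  obtains u where "u \<in> U" "worst V x u = bellman V x"
    "\<And>v. v \<in> U \<Longrightarrow> bellman V x \<le> worst V x v"
proof -
  have "continuous_on U (worst V x)"
    by (intro continuous_on_worst V continuous_intros)
  from continuous_attains_inf[OF U(1,3) this]
  obtain u where u: "u \<in> U" "\<And>v. v \<in> U \<Longrightarrow> worst V x u \<le> worst V x v" by blast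
  have "bellman V x = worst V x u"
    unfolding bellman_def using u by (intro cInf_eq_minimum) auto
  with u show thesis using that by metis
qed

lemma bellman_le: "convex_on UNIV V \<Longrightarrow> u \<in> U \<Longrightarrow> bellman V x \<le> worst V x u"
  by (metis bellman_attained)

text \<open>Partial minimisation of a jointly convex function over a convex set.  Convexity of the iterates is
what makes them continuous, so that the extrema of the next iteration are attained.\<close>

lemma convex_on_bellman:
  assumes V: "convex_on UNIV V"
  shows "convex_on UNIV (bellman V)"
proof (rule convex_onI)
  fix t :: real and x z assume t: "0 < t" "t < 1"
  obtain u where u: "u \<in> U" "worst V x u = bellman V x" using bellman_attained[OF V] by metis
  obtain v where v: "v \<in> U" "worst V z v = bellman V z" using bellman_attained[OF V] by metis
  have "linepath u v t \<in> U"
    using U(2) u v t by (simp add: linepath_def convexD)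
  then have "bellman V (linepath x z t) \<le> worst V (linepath x z t) (linepath u v t)"
    by (rule bellman_le[OF V])
  also have "\<dots> \<le> (1 - t) * bellman V x + t * bellman V z"
    using worst_convex[OF V, of t x z u v] u v t by simp
  finally show "bellman V ((1 - t) *\<^sub>R x + t *\<^sub>R z) \<le> (1 - t) * bellman V x + t * bellman V z"
    by (simp add: linepath_def)
qed auto

text \<open>The inductive step.  Since c bounds the cost of (z, v) for every disturbance, domination at the
successor states yields a strict secant bound for every w, whether or not w is a worst case at
(x, u).  The modulus \<open>\<rho> (v - u)\<close> survives because strong convexity contributes
\<open>t * (1 - t) * \<rho> (v - u)\<close>, and the deficit is of second order in t.\<close>

lemma worst_secant:
  assumes V: "convex_on UNIV V" and F: "tangent_dominates F V S"
    and S: "\<And>w. w \<in> W \<Longrightarrow> f x u w \<in> S"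
    and c: "\<And>w. w \<in> W \<Longrightarrow> ereal (l z v w) + F (f z v w) \<le> ereal c"
    and e: "0 < e"
  shows "\<forall>\<^sub>F t in at_right 0. worst V (linepath x z t) (linepath u v t)
           \<le> (1 - t) * worst V x u + t * (c - \<rho> (v - u) + e)"
proof -
  define \<phi> where "\<phi> t w = l (linepath x z t) (linepath u v t) w
    + V (linepath (f x u w) (f z v w) t)" for t w
  have "\<forall>\<^sub>F t in at_right 0. \<forall>w\<in>W. \<phi> t w \<le> (1 - t) * worst V x u + t * (c - \<rho> (v - u) + e)"
  proof (rule uniform_secant_bound[OF W(1)])
    show "continuous_on W (\<phi> t)" for t
      unfolding \<phi>_def linepath_def by (intro continuous_intros continuous_on_convex[OF V])
    show "\<phi> (s * t) w \<le> (1 - s) * \<phi> 0 w + s * \<phi> t w" if s: "0 \<le> s" "s \<le> 1" for s t w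
    proof -
      \<comment> \<open>The point at parameter \<open>s * t\<close> divides the segment up to parameter t in ratio s.\<close>
      have lp: "linepath a b (s * t) = linepath a (linepath a b t) s" for a b :: "'a::real_normed_vector"
        by (simp add: linepath_def algebra_simps)
      show ?thesis
        using l_convex[OF s, of x "linepath x z t" u "linepath u v t" w]
          convex_on_linepathD[OF V s, of "f x u w" "linepath (f x u w) (f z v w) t"]
        by (simp add: \<phi>_def lp linepath_0' algebra_simps)
    qed
    show "\<phi> 0 w \<le> worst V x u" if "w \<in> W" for w
      using worst_upper[OF V that] by (simp add: \<phi>_def linepath_0')
    show "\<exists>t. 0 < t \<and> t \<le> 1 \<and> \<phi> t w < (1 - t) * worst V x u + t * (c - \<rho> (v - u) + e)"
      if w: "w \<in> W" for w
    proof -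
      have "F (f z v w) \<le> ereal (c - l z v w)"
        using c[OF w] by (cases "F (f z v w)") auto
      then have "\<forall>\<^sub>F t in at_right 0. V (linepath (f x u w) (f z v w) t)
          \<le> (1 - t) * V (f x u w) + t * (c - l z v w + e / 2)"
        using F S[OF w] e unfolding tangent_dominates_def by (metis half_gt_zero)
      moreover have "\<forall>\<^sub>F t in at_right 0. t * \<rho> (v - u) < e / 2"
      proof (rule order_tendstoD)
        show "((\<lambda>t. t * \<rho> (v - u)) \<longlongrightarrow> 0 * \<rho> (v - u)) (at_right 0)"
          by (intro tendsto_intros)
      qed (use e in auto)
      moreover have "\<forall>\<^sub>F t in at_right (0::real). 0 < t \<and> t < 1"
        unfolding eventually_at_right_field by (intro exI[of _ 1]) auto
      ultimately have "\<forall>\<^sub>F t in at_right 0. V (linepath (f x u w) (f z v w) t)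
          \<le> (1 - t) * V (f x u w) + t * (c - l z v w + e / 2) \<and> t * \<rho> (v - u) < e / 2
          \<and> 0 < t \<and> t < 1"
        by eventually_elim auto
      then obtain t where t: "0 < t" "t < 1" "t * \<rho> (v - u) < e / 2"
        and Vt: "V (linepath (f x u w) (f z v w) t)
          \<le> (1 - t) * V (f x u w) + t * (c - l z v w + e / 2)"
        using eventually_happens'[OF trivial_limit_at_right_real] by blast
      have "\<phi> t w \<le> ((1 - t) * l x u w + t * l z v w - t * (1 - t) * \<rho> (v - u))
          + ((1 - t) * V (f x u w) + t * (c - l z v w + e / 2))"
        unfolding \<phi>_def using t by (intro add_mono Vt l_strongly_convex) auto
      also have "\<dots> = (1 - t) * (l x u w + V (f x u w))
          + t * (c - \<rho> (v - u) + (t * \<rho> (v - u) + e / 2))"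
        by (simp add: algebra_simps)
      also have "\<dots> < (1 - t) * worst V x u + t * (c - \<rho> (v - u) + e)"
        using t worst_upper[OF V w, of x u]
        by (intro add_le_less_mono mult_left_mono mult_strict_left_mono) auto
      finally show ?thesis using t by (intro exI[of _ t]) auto
    qed
  qed
  then show ?thesis
    by eventually_elim (rule worst_least, simp add: \<phi>_def f_linepath)
qed

end

section \<open>Value iteration from a terminal set\<close>

text \<open>The terminal cost enters through its tangents: \<open>\<tau> x\<close> is the tangent of \<open>Vf\<close> at x.  The
saddle conditions are those of the unconstrained linear-quadratic game: against the
disturbance \<open>Kw x\<close> every control u costs at least the tangent plus \<open>\<rho> (u - Ku x)\<close>, and against
the control \<open>Ku x\<close> no disturbance gains more than \<open>Vf x\<close>.\<close>

locale terminal_game = convex_game f l U W \<rho>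
  for f :: "'x::euclidean_space \<Rightarrow> 'u::euclidean_space \<Rightarrow> 'w::euclidean_space \<Rightarrow> 'x"
    and l :: "'x \<Rightarrow> 'u \<Rightarrow> 'w \<Rightarrow> real"
    and U :: "'u set" and W :: "'w set" and \<rho> :: "'u \<Rightarrow> real" +
  fixes Vf :: "'x \<Rightarrow> real" and \<tau> :: "'x \<Rightarrow> 'x \<Rightarrow> real"
    and Ku :: "'x \<Rightarrow> 'u" and Kw :: "'x \<Rightarrow> 'w" and Xf :: "'x set"
  assumes convex_Vf: "convex_on UNIV Vf"
    and tangent_refl: "\<tau> x x = Vf x"
    and tangent_le: "\<tau> x z \<le> Vf z"
    and tangent_secant: "0 < e \<Longrightarrow>
      \<forall>\<^sub>F t in at_right 0. Vf (linepath x z t) \<le> (1 - t) * Vf x + t * (\<tau> x z + e)"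
    and saddle_lower:
      "\<tau> x z + \<rho> (u - Ku x) \<le> l z u (Kw x) + \<tau> (f x (Ku x) (Kw x)) (f z u (Kw x))"
    and saddle_upper: "l x (Ku x) w + Vf (f x (Ku x) w) \<le> Vf x"
    and compact_Xf: "compact Xf" and Xf_nonempty: "Xf \<noteq> {}"
    and Ku_in: "x \<in> Xf \<Longrightarrow> Ku x \<in> U"
    and Kw_in: "x \<in> Xf \<Longrightarrow> Kw x \<in> W"
    and Xf_invariant: "x \<in> Xf \<Longrightarrow> w \<in> W \<Longrightarrow> f x (Ku x) w \<in> Xf"
begin

abbreviation V :: "nat \<Rightarrow> 'x \<Rightarrow> real" where "V \<equiv> value_iter f l U W Vf"
abbreviation \<kappa> :: "nat \<Rightarrow> 'x \<Rightarrow> 'u" where "\<kappa> \<equiv> control_law f l U W Vf"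
abbreviation X :: "nat \<Rightarrow> 'x set" where "X \<equiv> domain_set f l U W Vf Xf"

declare value_iter.simps(2) [simp del]

lemma value_iter_Suc: "V (Suc k) = bellman (V k)"
  by (simp add: bellman_def worst_def fun_eq_iff value_iter.simps(2))

lemma convex_V: "convex_on UNIV (V k)"
  by (induction k) (simp_all only: value_iter.simps(1) value_iter_Suc convex_Vf convex_on_bellman)

lemma control_law_minimises:
  shows control_law_in: "\<kappa> (Suc k) x \<in> U"
    and worst_control_law: "worst (V k) x (\<kappa> (Suc k) x) = V (Suc k) x"
proof -
  obtain u where u: "u \<in> U" "worst (V k) x u = bellman (V k) x"
    and le: "\<And>v. v \<in> U \<Longrightarrow> bellman (V k) x \<le> worst (V k) x v"
    using bellman_attained[OF convex_V] by metis
  have "is_arg_min (worst (V k) x) (\<lambda>u. u \<in> U) u"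
    unfolding is_arg_min_def using u le by (auto simp: not_less)
  moreover have "\<kappa> (Suc k) x = (SOME u. is_arg_min (worst (V k) x) (\<lambda>u. u \<in> U) u)"
    by (simp add: control_law_def arg_min_on_def arg_min_def worst_def[abs_def])
  ultimately have m: "is_arg_min (worst (V k) x) (\<lambda>u. u \<in> U) (\<kappa> (Suc k) x)"
    by (simp add: someI)
  then show "\<kappa> (Suc k) x \<in> U" by (simp add: is_arg_min_def)
  moreover have "worst (V k) x (\<kappa> (Suc k) x) \<le> worst (V k) x u"
    using m u(1) by (auto simp: is_arg_min_def not_less)
  ultimately show "worst (V k) x (\<kappa> (Suc k) x) = V (Suc k) x"
    using u le by (metis order_antisym value_iter_Suc)
qed

lemma saddle_point_in: "x \<in> Xf \<Longrightarrow> f x (Ku x) (Kw x) \<in> Xf"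
  by (intro Xf_invariant Kw_in)

text \<open>Playing \<open>Kw x\<close> for an x in the terminal set is always admissible, whatever the current state z.
Hence tangents at points of the terminal set are global lower bounds of all iterates, even
though \<open>Vf\<close> itself need not be one.\<close>

lemma tangent_le_V: "x \<in> Xf \<Longrightarrow> \<tau> x z \<le> V k z"
  and tangent_le_worst: "x \<in> Xf \<Longrightarrow> \<tau> x z + \<rho> (u - Ku x) \<le> worst (V k) z u"
proof -
  have worst: "\<tau> x z + \<rho> (u - Ku x) \<le> worst (V k) z u"
    if IH: "\<And>x z. x \<in> Xf \<Longrightarrow> \<tau> x z \<le> V k z" and x: "x \<in> Xf" for x z u k
  proof -
    have "\<tau> x z + \<rho> (u - Ku x) \<le> l z u (Kw x) + V k (f z u (Kw x))"
      using saddle_lower[of x z u] IH[OF saddle_point_in[OF x], of "f z u (Kw x)"] by linarith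
    also have "\<dots> \<le> worst (V k) z u"
      by (rule worst_upper[OF convex_V Kw_in[OF x]])
    finally show ?thesis .
  qed
  have V: "x \<in> Xf \<Longrightarrow> \<tau> x z \<le> V k z" for x z k
  proof (induction k arbitrary: x z)
    case 0
    then show ?case by (simp add: tangent_le)
  next
    case (Suc k)
    have "\<tau> x z \<le> worst (V k) z (\<kappa> (Suc k) z)"
      using worst[OF Suc.IH Suc.prems, of z "\<kappa> (Suc k) z"] \<rho>_nonneg by (smt (verit))
    then show ?case by (simp add: worst_control_law)
  qed
  then show "x \<in> Xf \<Longrightarrow> \<tau> x z \<le> V k z" .
  show "x \<in> Xf \<Longrightarrow> \<tau> x z + \<rho> (u - Ku x) \<le> worst (V k) z u"
    using worst V by blast
qed

lemma V_on_Xf: "x \<in> Xf \<Longrightarrow> V k x = Vf x"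
proof (induction k arbitrary: x)
  case (Suc k)
  have "V (Suc k) x \<le> worst (V k) x (Ku x)"
    unfolding value_iter_Suc by (rule bellman_le[OF convex_V Ku_in[OF Suc.prems]])
  also have "\<dots> \<le> Vf x"
    using Suc saddle_upper[of x] by (intro worst_least) (simp add: Xf_invariant)
  finally show ?case
    using tangent_le_V[OF Suc.prems, of x "Suc k"] by (simp add: tangent_refl)
qed simp

lemma minimiser_on_Xf:
  assumes "x \<in> Xf" "worst (V k) x u \<le> Vf x"
  shows "u = Ku x"
proof -
  have "\<rho> (u - Ku x) \<le> 0"
    using tangent_le_worst[OF assms(1), of x u k] assms(2) by (simp add: tangent_refl)
  then show ?thesis using \<rho>_zero by fastforce
qed

lemma control_law_on_Xf: "x \<in> Xf \<Longrightarrow> \<kappa> (Suc k) x = Ku x"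
  by (rule minimiser_on_Xf[of _ k]) (simp_all only: worst_control_law V_on_Xf)

text \<open>The sequences F and \<open>\<mu>\<close> stand for any solution of the same recursion that starts above the
tangents of \<open>Vf\<close> and does not exceed \<open>Vf\<close> on the terminal set.  Both \<open>F k = V (Suc k)\<close> and the
constant sequence \<open>F k = J\<close> qualify, so that one induction serves both horizons.\<close>

lemma minimiser_agreement:
  fixes F :: "nat \<Rightarrow> 'x \<Rightarrow> ereal" and \<mu> :: "nat \<Rightarrow> 'x \<Rightarrow> 'u"
  assumes \<mu>: "\<And>k x. \<mu> (Suc k) x \<in> U"
    and F_ge: "\<And>k x w. w \<in> W \<Longrightarrow>
      ereal (l x (\<mu> (Suc k) x) w) + F k (f x (\<mu> (Suc k) x) w) \<le> F (Suc k) x"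
    and F_le: "\<And>k x u c. u \<in> U \<Longrightarrow>
      (\<And>w. w \<in> W \<Longrightarrow> ereal (l x u w) + F k (f x u w) \<le> ereal c) \<Longrightarrow> F (Suc k) x \<le> ereal c"
    and F0_ge: "\<And>x z. x \<in> Xf \<Longrightarrow> ereal (\<tau> x z) \<le> F 0 z"
    and F0_le: "\<And>x. x \<in> Xf \<Longrightarrow> F 0 x \<le> ereal (Vf x)"
  shows "x \<in> X (Suc k) \<Longrightarrow> \<mu> (Suc k) x = \<kappa> (Suc k) x"
proof -
  have step: "\<forall>\<^sub>F t in at_right 0. worst (V k) (linepath x z t)
        (linepath (\<kappa> (Suc k) x) (\<mu> (Suc k) z) t)
      \<le> (1 - t) * V (Suc k) x + t * (c - \<rho> (\<mu> (Suc k) z - \<kappa> (Suc k) x) + e)"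
    if "tangent_dominates (F k) (V k) (X k)" "x \<in> X (Suc k)" "F (Suc k) z \<le> ereal c" "0 < e"
    for k x z c e
    unfolding worst_control_law[symmetric]
  proof (rule worst_secant[OF convex_V that(1)])
    show "f x (\<kappa> (Suc k) x) w \<in> X k" if "w \<in> W" for w
      using \<open>x \<in> X (Suc k)\<close> that by auto
    show "ereal (l z (\<mu> (Suc k) z) w) + F k (f z (\<mu> (Suc k) z) w) \<le> ereal c" if "w \<in> W" for w
      using F_ge[OF that] \<open>F (Suc k) z \<le> ereal c\<close> by (rule order_trans)
  qed fact
  have le_step: "F (Suc k) x \<le> ereal (V (Suc k) x)"
    if IH: "\<forall>x\<in>X k. F k x \<le> ereal (V k x)" and x: "x \<in> X (Suc k)" for k x
  proof (rule F_le[OF control_law_in])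
    fix w assume w: "w \<in> W"
    have "F k (f x (\<kappa> (Suc k) x) w) \<le> ereal (V k (f x (\<kappa> (Suc k) x) w))"
      using IH x w by auto
    then have "ereal (l x (\<kappa> (Suc k) x) w) + F k (f x (\<kappa> (Suc k) x) w)
        \<le> ereal (l x (\<kappa> (Suc k) x) w) + ereal (V k (f x (\<kappa> (Suc k) x) w))"
      by (intro add_mono) auto
    also have "\<dots> \<le> ereal (V (Suc k) x)"
      using worst_upper[OF convex_V w, of x "\<kappa> (Suc k) x" k] by (simp only: worst_control_law) simp
    finally show "ereal (l x (\<kappa> (Suc k) x) w) + F k (f x (\<kappa> (Suc k) x) w) \<le> ereal (V (Suc k) x)" .
  qed
  have dom: "tangent_dominates (F k) (V k) (X k) \<and> (\<forall>x\<in>X k. F k x \<le> ereal (V k x))" for k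
  proof (induction k)
    case 0
    have "tangent_dominates (F 0) Vf Xf"
      unfolding tangent_dominates_def
    proof (intro ballI allI impI)
      fix x z c and e :: real
      assume x: "x \<in> Xf" and c: "F 0 z \<le> ereal c" and e: "0 < e"
      have "\<tau> x z \<le> c" using order_trans[OF F0_ge[OF x] c] by simp
      then have le: "t * (\<tau> x z + e) \<le> t * (c + e)" if "0 < t" for t
        using that by simp
      show "\<forall>\<^sub>F t in at_right 0. Vf (linepath x z t) \<le> (1 - t) * Vf x + t * (c + e)"
        using tangent_secant[OF e, of x z] eventually_at_right_less[of "0::real"]
      proof eventually_elim
        case (elim t)
        show ?case using elim(1) le[OF elim(2)] by linarith
      qed
    qed
    then show ?case using F0_le by simp
  next
    case (Suc k)
    have "tangent_dominates (F (Suc k)) (V (Suc k)) (X (Suc k))"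
      unfolding tangent_dominates_def
    proof (intro ballI allI impI)
      fix x z c and e :: real
      assume x: "x \<in> X (Suc k)" and c: "F (Suc k) z \<le> ereal c" and e: "0 < e"
      let ?u = "\<kappa> (Suc k) x" and ?v = "\<mu> (Suc k) z"
      have "\<forall>\<^sub>F t in at_right (0::real). 0 < t \<and> t < 1"
        unfolding eventually_at_right_field by (intro exI[of _ 1]) auto
      with step[OF conjunct1[OF Suc.IH] x c e]
      show "\<forall>\<^sub>F t in at_right 0. V (Suc k) (linepath x z t) \<le> (1 - t) * V (Suc k) x + t * (c + e)"
      proof eventually_elim
        case (elim t)
        have "linepath ?u ?v t \<in> U"
          using U(2) control_law_in[of k x] \<mu>[of k z] elim by (simp add: linepath_def convexD)
        then have "V (Suc k) (linepath x z t) \<le> worst (V k) (linepath x z t) (linepath ?u ?v t)"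
          unfolding value_iter_Suc by (rule bellman_le[OF convex_V])
        also note elim(1)
        also have "(1 - t) * V (Suc k) x + t * (c - \<rho> (?v - ?u) + e)
            \<le> (1 - t) * V (Suc k) x + t * (c + e)"
          using elim \<rho>_nonneg[of "?v - ?u"] by (intro add_left_mono mult_left_mono) auto
        finally show ?case .
      qed
    qed
    then show ?case using le_step Suc.IH by blast
  qed
  show "\<mu> (Suc k) x = \<kappa> (Suc k) x" if x: "x \<in> X (Suc k)"
  proof -
    let ?u = "\<kappa> (Suc k) x" and ?v = "\<mu> (Suc k) x"
    \<comment> \<open>Domination is applied with \<open>z = x\<close>: moving from one minimiser towards another would lower the
      cost at rate \<open>\<rho> (?v - ?u)\<close>, but no admissible control at x costs less than \<open>V (Suc k) x\<close>.\<close>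
    have "\<rho> (?v - ?u) \<le> 0 + e" if e: "0 < e" for e
    proof -
      have "\<forall>\<^sub>F t in at_right 0. worst (V k) (linepath x x t) (linepath ?u ?v t)
          \<le> (1 - t) * V (Suc k) x + t * (V (Suc k) x - \<rho> (?v - ?u) + e)"
        using step[OF conjunct1[OF dom] x le_step[OF conjunct2[OF dom] x] e] .
      moreover have "\<forall>\<^sub>F t in at_right (0::real). 0 < t \<and> t < 1"
        unfolding eventually_at_right_field by (intro exI[of _ 1]) auto
      ultimately have "\<forall>\<^sub>F t in at_right 0. (0 < t \<and> t < 1)
          \<and> worst (V k) (linepath x x t) (linepath ?u ?v t)
            \<le> (1 - t) * V (Suc k) x + t * (V (Suc k) x - \<rho> (?v - ?u) + e)"
        by eventually_elim blast
      then obtain t where t: "0 < t" "t < 1"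
        and le: "worst (V k) (linepath x x t) (linepath ?u ?v t)
          \<le> (1 - t) * V (Suc k) x + t * (V (Suc k) x - \<rho> (?v - ?u) + e)"
        using eventually_happens'[OF trivial_limit_at_right_real] by blast
      have "linepath ?u ?v t \<in> U"
        using U(2) control_law_in[of k x] \<mu>[of k x] t by (simp add: linepath_def convexD)
      then have "V (Suc k) x \<le> worst (V k) x (linepath ?u ?v t)"
        unfolding value_iter_Suc by (rule bellman_le[OF convex_V])
      also have "\<dots> \<le> (1 - t) * V (Suc k) x + t * (V (Suc k) x - \<rho> (?v - ?u) + e)"
        using le by simp
      finally have "0 \<le> t * (e - \<rho> (?v - ?u))" by (simp add: algebra_simps)
      then show ?thesis using t by (simp add: zero_le_mult_iff)
    qed
    then have "\<rho> (?v - ?u) \<le> 0" by (rule field_le_epsilon)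
    then show ?thesis using \<rho>_zero by fastforce
  qed
qed

lemma control_law_stationary: "x \<in> X (Suc k) \<Longrightarrow> \<kappa> (Suc (Suc k)) x = \<kappa> (Suc k) x"
proof (rule minimiser_agreement[where F = "\<lambda>k x. ereal (V (Suc k) x)" and \<mu> = "\<lambda>k. \<kappa> (Suc k)"])
  show "\<kappa> (Suc (Suc k)) x \<in> U" for k x by (rule control_law_in)
  show "ereal (l x (\<kappa> (Suc (Suc k)) x) w) + ereal (V (Suc k) (f x (\<kappa> (Suc (Suc k)) x) w))
      \<le> ereal (V (Suc (Suc k)) x)" if "w \<in> W" for k x w
    using worst_upper[OF convex_V that, of x "\<kappa> (Suc (Suc k)) x" "Suc k"]
    by (simp add: worst_control_law)
  show "ereal (V (Suc (Suc k)) x) \<le> ereal c"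
    if "u \<in> U" and c: "\<And>w. w \<in> W \<Longrightarrow> ereal (l x u w) + ereal (V (Suc k) (f x u w)) \<le> ereal c"
    for k x u c
  proof -
    have "V (Suc (Suc k)) x \<le> worst (V (Suc k)) x u"
      using bellman_le[OF convex_V \<open>u \<in> U\<close>, of "Suc k" x] by (simp only: value_iter_Suc)
    also have "\<dots> \<le> c" using c by (intro worst_least) simp
    finally show ?thesis by simp
  qed
  show "ereal (\<tau> x z) \<le> ereal (V (Suc 0) z)" if "x \<in> Xf" for x z
    using tangent_le_V[OF that, of z "Suc 0"] by simp
  show "ereal (V (Suc 0) x) \<le> ereal (Vf x)" if "x \<in> Xf" for x
    using V_on_Xf[OF that, of "Suc 0"] by simp
qed

lemma domain_set_mono: "X k \<subseteq> X (Suc k)"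
proof (induction k)
  case 0
  show ?case using control_law_on_Xf[of _ 0] Xf_invariant by auto
next
  case (Suc k)
  show ?case
  proof
    fix x assume x: "x \<in> X (Suc k)"
    then have "f x (\<kappa> (Suc k) x) ` W \<subseteq> X k" by simp
    then have "f x (\<kappa> (Suc (Suc k)) x) ` W \<subseteq> X (Suc k)"
      using Suc control_law_stationary[OF x] by auto
    then show "x \<in> X (Suc (Suc k))" by simp
  qed
qed

lemma domain_set_mono': "j \<le> k \<Longrightarrow> X j \<subseteq> X k"
  using domain_set_mono by (rule lift_Suc_mono_le)

lemma domain_set_invariant: "robust_control_invariant f U W (X k)"
proof (cases k)
  case 0
  then show ?thesis
    using Ku_in Xf_invariant unfolding robust_control_invariant_def by auto
next
  case (Suc j)
  have "f x (\<kappa> (Suc j) x) ` W \<subseteq> X (Suc j)" if "x \<in> X (Suc j)" for x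
    using that domain_set_mono[of j] by fastforce
  then show ?thesis
    unfolding Suc robust_control_invariant_def using control_law_in by blast
qed

end

text \<open>J is a fixed point of the Bellman operator with minimiser \<open>\<kappa>_inf\<close>, bounded by \<open>Vf\<close> on the terminal
set and by its tangents from below.  It is extended-real valued because an unstable plant with
bounded controls can have states of infinite cost.\<close>

locale optimal_closed_loop = terminal_game f l U W \<rho> Vf \<tau> Ku Kw Xf
  for f :: "'x::euclidean_space \<Rightarrow> 'u::euclidean_space \<Rightarrow> 'w::euclidean_space \<Rightarrow> 'x"
    and l U W \<rho> Vf \<tau> Ku Kw Xf +
  fixes J :: "'x \<Rightarrow> ereal" and \<kappa>_inf :: "'x \<Rightarrow> 'u"
  assumes \<kappa>_inf_in: "\<kappa>_inf x \<in> U"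
    and J_ge: "w \<in> W \<Longrightarrow> ereal (l x (\<kappa>_inf x) w) + J (f x (\<kappa>_inf x) w) \<le> J x"
    and J_le: "u \<in> U \<Longrightarrow>
      (\<And>w. w \<in> W \<Longrightarrow> ereal (l x u w) + J (f x u w) \<le> ereal c) \<Longrightarrow> J x \<le> ereal c"
    and J_ge_tangent: "x \<in> Xf \<Longrightarrow> ereal (\<tau> x z) \<le> J z"
    and J_le_Vf: "x \<in> Xf \<Longrightarrow> J x \<le> ereal (Vf x)"
begin

lemma optimal_law_on_domain: "x \<in> X (Suc k) \<Longrightarrow> \<kappa>_inf x = \<kappa> (Suc k) x"
  by (rule minimiser_agreement[where F = "\<lambda>_. J" and \<mu> = "\<lambda>_. \<kappa>_inf"])
     (auto simp: \<kappa>_inf_in J_ge J_ge_tangent J_le_Vf intro: J_le)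

lemma optimal_law_on_Xf: "x \<in> Xf \<Longrightarrow> \<kappa>_inf x = Ku x"
  using optimal_law_on_domain[of x 0] control_law_on_Xf[of x 0] domain_set_mono[of 0] by auto

lemma trajectory_domain:
  assumes "x \<in> X N" "\<And>i. w i \<in> W"
  shows "trajectory f (\<lambda>_. \<kappa>_inf) w x i \<in> X (N - i)"
proof (induction i)
  case (Suc i)
  show ?case
  proof (cases "N - i")
    case 0
    then show ?thesis
      using Suc assms(2) by (auto simp: optimal_law_on_Xf intro!: Xf_invariant)
  next
    case (Suc m)
    then have "N - Suc i = m" by simp
    then show ?thesis
      using \<open>trajectory f (\<lambda>_. \<kappa>_inf) w x i \<in> X (N - i)\<close> assms(2) Suc
      by (auto simp: optimal_law_on_domain[of _ m])
  qed
qed (simp add: assms)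

lemma attractive: "finite_time_attractive f \<kappa>_inf W Xf N (X N)"
  unfolding finite_time_attractive_def
proof (intro ballI allI impI exI[of _ N] conjI)
  fix x w i assume "x \<in> X N" "\<forall>i::nat. w i \<in> W" "N \<le> i"
  then show "trajectory f (\<lambda>_. \<kappa>_inf) w x i \<in> Xf"
    using trajectory_domain[of x N w i] by simp
qed simp

text \<open>Robustness of one step, by compactness.  The triples (x, u, w)
in which u is optimal at x and x is sent at least \<open>\<epsilon>\<close> away from the terminal set form a compact set.
No x from such a triple lies in the terminal set, where the only optimal control is
\<open>Ku x\<close>, so these x keep a positive distance from it.\<close>

lemma near_Xf_step:
  assumes "0 < \<epsilon>"
  obtains \<delta> where "0 < \<delta>"
    "\<And>x w. infdist x Xf < \<delta> \<Longrightarrow> w \<in> W \<Longrightarrow> infdist (f x (\<kappa> (Suc k) x) w) Xf < \<epsilon>"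
proof -
  \<comment> \<open>The radius 1 is arbitrary; it only makes the set of states compact.\<close>
  define N where "N = {x. infdist x Xf \<le> 1} \<times> U \<times> W"
  define S where "S = {p\<in>N. worst (V k) (fst p) (fst (snd p)) \<le> V (Suc k) (fst p)
    \<and> \<epsilon> \<le> infdist (f (fst p) (fst (snd p)) (snd (snd p))) Xf}"
  have "compact N"
    unfolding N_def
    by (intro compact_Times compact_infdist_le Xf_nonempty compact_Xf U W) simp
  moreover have "closed {p. worst (V k) (fst p) (fst (snd p)) \<le> V (Suc k) (fst p)
    \<and> \<epsilon> \<le> infdist (f (fst p) (fst (snd p)) (snd (snd p))) Xf}"
    by (intro closed_Collect_conj closed_Collect_le continuous_on_infdist continuous_on_f
        continuous_on_worst[OF convex_V] continuous_on_convex[OF convex_V]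
        continuous_on_const continuous_on_fst continuous_on_snd continuous_on_id)
  ultimately have S: "compact S"
    unfolding S_def Collect_conj_eq by (simp add: compact_Int_closed)
  have pos: "0 < infdist (fst p) Xf" if "p \<in> S" for p
  proof (rule ccontr)
    assume "\<not> 0 < infdist (fst p) Xf"
    then have "infdist (fst p) Xf = 0" using infdist_nonneg[of "fst p" Xf] by simp
    then have x: "fst p \<in> Xf"
      using in_closed_iff_infdist_zero[OF compact_imp_closed[OF compact_Xf] Xf_nonempty] by simp
    then have "fst (snd p) = Ku (fst p)"
      using that by (intro minimiser_on_Xf[of _ k]) (auto simp: S_def V_on_Xf)
    then have "f (fst p) (fst (snd p)) (snd (snd p)) \<in> Xf"
      using that x by (auto simp: S_def N_def intro: Xf_invariant)
    then show False using that assms by (auto simp: S_def)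
  qed
  obtain d where d: "0 < d" "\<And>p. p \<in> S \<Longrightarrow> d \<le> infdist (fst p) Xf"
  proof (cases "S = {}")
    case True
    then show thesis using that[of 1] by auto
  next
    case False
    have "continuous_on S (\<lambda>p. infdist (fst p) Xf)" by (intro continuous_intros)
    from continuous_attains_inf[OF S False this] show thesis using that pos by blast
  qed
  show thesis
  proof (rule that[of "min 1 d"])
    show "infdist (f x (\<kappa> (Suc k) x) w) Xf < \<epsilon>" if "infdist x Xf < min 1 d" "w \<in> W" for x w
    proof (rule ccontr)
      assume "\<not> ?thesis"
      then have "(x, \<kappa> (Suc k) x, w) \<in> S"
        using that control_law_in[of k x] worst_control_law[of k x]
        by (simp add: S_def N_def)
      then show False using d(2) that by fastforce
    qed
  qed (use d in simp)
qed

lemma near_Xf_steps: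
  assumes "0 < \<epsilon>"
  shows "\<exists>\<delta>>0. \<forall>x w. x \<in> X (Suc k) \<longrightarrow> infdist x Xf < \<delta> \<longrightarrow> (\<forall>i. w i \<in> W) \<longrightarrow>
    (\<forall>i\<le>n. infdist (trajectory f (\<lambda>_. \<kappa>_inf) w x i) Xf < \<epsilon>)"
  using assms
proof (induction n arbitrary: \<epsilon>)
  case 0
  then show ?case by (intro exI[of _ \<epsilon>]) auto
next
  case (Suc n)
  obtain \<eta> where \<eta>: "0 < \<eta>"
    "\<And>x w. infdist x Xf < \<eta> \<Longrightarrow> w \<in> W \<Longrightarrow> infdist (f x (\<kappa> (Suc k) x) w) Xf < \<epsilon>"
    using near_Xf_step[OF Suc.prems] by blast
  obtain \<delta> where \<delta>: "0 < \<delta>" "\<And>x w i. x \<in> X (Suc k) \<Longrightarrow> infdist x Xf < \<delta> \<Longrightarrow> \<forall>i. w i \<in> W \<Longrightarrow>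
      i \<le> n \<Longrightarrow> infdist (trajectory f (\<lambda>_. \<kappa>_inf) w x i) Xf < min \<epsilon> \<eta>"
    using Suc.IH[of "min \<epsilon> \<eta>"] Suc.prems \<eta>(1) by (metis min_less_iff_conj)
  have "infdist (trajectory f (\<lambda>_. \<kappa>_inf) w x i) Xf < \<epsilon>"
    if x: "x \<in> X (Suc k)" "infdist x Xf < \<delta>" and w: "\<forall>i::nat. w i \<in> W" and i: "i \<le> Suc n"
    for x w i
  proof (cases "i \<le> n")
    case True
    then show ?thesis using \<delta>(2)[OF x w] by simp
  next
    case False
    then have i: "i = Suc n" using i by simp
    let ?y = "trajectory f (\<lambda>_. \<kappa>_inf) w x n"
    have "?y \<in> X (Suc k)"
      using trajectory_domain[of x "Suc k" w n] x w domain_set_mono'[of "Suc k - n" "Suc k"]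
      by (meson diff_le_self subsetD)
    then show ?thesis
      using \<eta>(2)[of ?y "w n"] \<delta>(2)[OF x w, of n] w i by (simp add: optimal_law_on_domain[of _ k])
  qed
  then show ?case using \<delta>(1) by blast
qed

lemma stable:
  assumes "Xf \<subseteq> interior (X j)"
  shows "robustly_stable f \<kappa>_inf W Xf"
  unfolding robustly_stable_def
proof (intro allI impI)
  fix \<epsilon> :: real assume \<epsilon>: "0 < \<epsilon>"
  \<comment> \<open>Passing to \<open>Suc j\<close> covers \<open>j = 0\<close>, to which no law \<open>\<kappa> j\<close> belongs.\<close>
  have "X j \<subseteq> X (Suc j)" by (rule domain_set_mono)
  then have "Xf \<subseteq> interior (X (Suc j))" using assms interior_mono by blast
  then obtain r where r: "0 < r" "(\<Union>x\<in>Xf. ball x r) \<subseteq> interior (X (Suc j))"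
    using compact_subset_open_imp_ball_epsilon_subset[OF compact_Xf open_interior] by metis
  have near: "x \<in> X (Suc j)" if "infdist x Xf < r" for x
  proof -
    obtain y where "y \<in> Xf" "infdist x Xf = dist x y"
      using infdist_attains_inf[OF compact_imp_closed[OF compact_Xf] Xf_nonempty] by metis
    then have "x \<in> (\<Union>y\<in>Xf. ball y r)" using that by (auto simp: dist_commute)
    then show ?thesis using r(2) interior_subset by blast
  qed
  obtain \<delta> where \<delta>: "0 < \<delta>" "\<And>x w i. x \<in> X (Suc j) \<Longrightarrow> infdist x Xf < \<delta> \<Longrightarrow> \<forall>i. w i \<in> W \<Longrightarrow>
      i \<le> Suc j \<Longrightarrow> infdist (trajectory f (\<lambda>_. \<kappa>_inf) w x i) Xf < \<epsilon>"
    using near_Xf_steps[OF \<epsilon>, of j "Suc j"] by metis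
  have "infdist (trajectory f (\<lambda>_. \<kappa>_inf) w x i) Xf < \<epsilon>"
    if x: "infdist x Xf < min r \<delta>" and w: "\<forall>i::nat. w i \<in> W" for x w i
  proof (cases "i \<le> Suc j")
    case True
    then show ?thesis using \<delta>(2) near x w by simp
  next
    case False
    then have "trajectory f (\<lambda>_. \<kappa>_inf) w x i \<in> Xf"
      using trajectory_domain[of x "Suc j" w i] near x w by simp
    then show ?thesis using \<epsilon> by simp
  qed
  then show "\<exists>\<delta>>0. \<forall>x. infdist x Xf < \<delta> \<longrightarrow> (\<forall>w. (\<forall>i. w i \<in> W) \<longrightarrow>
      (\<forall>i. infdist (trajectory f (\<lambda>_. \<kappa>_inf) w x i) Xf < \<epsilon>))"
    using r(1) \<delta>(1) by (intro exI[of _ "min r \<delta>"]) auto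
qed

end

section \<open>Dynamic programming for the infinite horizon\<close>

lemma trajectory_Suc_shift:
  "trajectory f \<pi> w x (Suc i) =
     trajectory f (\<lambda>i. \<pi> (Suc i)) (\<lambda>i. w (Suc i)) (f x (\<pi> 0 x) (w 0)) i"
  by (induction i) simp_all

text \<open>The first stage cost is finite, so it can be split off from the upper limit.\<close>

lemma infinite_cost_unfold:
  "infinite_cost f l \<pi> w x = ereal (l x (\<pi> 0 x) (w 0))
     + infinite_cost f l (\<lambda>i. \<pi> (Suc i)) (\<lambda>i. w (Suc i)) (f x (\<pi> 0 x) (w 0))"
proof -
  let ?c = "\<lambda>\<pi> w x i. l (trajectory f \<pi> w x i) (\<pi> i (trajectory f \<pi> w x i)) (w i)"
  let ?c' = "?c (\<lambda>i. \<pi> (Suc i)) (\<lambda>i. w (Suc i)) (f x (\<pi> 0 x) (w 0))"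
  have "(\<Sum>i<Suc n. ?c \<pi> w x i) = l x (\<pi> 0 x) (w 0) + (\<Sum>i<n. ?c' i)" for n
    unfolding sum.lessThan_Suc_shift trajectory_Suc_shift by simp
  then have "infinite_cost f l \<pi> w x
      = limsup (\<lambda>n. ereal (l x (\<pi> 0 x) (w 0)) + ereal (\<Sum>i<n. ?c' i))"
    unfolding infinite_cost_def
    by (subst limsup_shift[symmetric]) (simp only: Suc_eq_plus1[symmetric] plus_ereal.simps)
  also have "\<dots> = ereal (l x (\<pi> 0 x) (w 0)) + limsup (\<lambda>n. ereal (\<Sum>i<n. ?c' i))"
    by (rule Limsup_add_ereal_left) simp_all
  finally show ?thesis by (simp only: infinite_cost_def)
qed

lemma worst_case_cost_ge:
  fixes W :: "'w set"
  assumes "v \<in> W"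
  shows "ereal (l x (\<pi> 0 x) v) + worst_case_cost f l W (\<lambda>i. \<pi> (Suc i)) (f x (\<pi> 0 x) v)
    \<le> worst_case_cost f l W \<pi> x"
proof -
  let ?\<Omega> = "{w::nat \<Rightarrow> 'w. \<forall>i. w i \<in> W}"
  have "ereal (l x (\<pi> 0 x) v) + worst_case_cost f l W (\<lambda>i. \<pi> (Suc i)) (f x (\<pi> 0 x) v)
      = (SUP w\<in>?\<Omega>. ereal (l x (\<pi> 0 x) v)
          + infinite_cost f l (\<lambda>i. \<pi> (Suc i)) w (f x (\<pi> 0 x) v))"
    unfolding worst_case_cost_def using assms by (intro SUP_ereal_add_right[symmetric]) auto
  also have "\<dots> \<le> worst_case_cost f l W \<pi> x"
  proof (rule SUP_least)
    fix w assume "w \<in> ?\<Omega>"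
    then have "case_nat v w \<in> ?\<Omega>" using assms by (auto split: nat.split)
    then have "infinite_cost f l \<pi> (case_nat v w) x \<le> worst_case_cost f l W \<pi> x"
      unfolding worst_case_cost_def by (rule SUP_upper)
    then show "ereal (l x (\<pi> 0 x) v) + infinite_cost f l (\<lambda>i. \<pi> (Suc i)) w (f x (\<pi> 0 x) v)
        \<le> worst_case_cost f l W \<pi> x"
      by (simp add: infinite_cost_unfold[of f l \<pi>])
  qed
  finally show ?thesis .
qed

lemma worst_case_cost_le:
  fixes W :: "'w set"
  assumes "\<And>v. v \<in> W \<Longrightarrow> ereal (l x (\<pi> 0 x) v)
      + worst_case_cost f l W (\<lambda>i. \<pi> (Suc i)) (f x (\<pi> 0 x) v) \<le> c"
  shows "worst_case_cost f l W \<pi> x \<le> c"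
  unfolding worst_case_cost_def
proof (rule SUP_least)
  fix w assume w: "w \<in> {w::nat \<Rightarrow> 'w. \<forall>i. w i \<in> W}"
  have "infinite_cost f l (\<lambda>i. \<pi> (Suc i)) (\<lambda>i. w (Suc i)) (f x (\<pi> 0 x) (w 0))
      \<le> worst_case_cost f l W (\<lambda>i. \<pi> (Suc i)) (f x (\<pi> 0 x) (w 0))"
    unfolding worst_case_cost_def using w by (intro SUP_upper) auto
  then have "infinite_cost f l \<pi> w x \<le> ereal (l x (\<pi> 0 x) (w 0))
      + worst_case_cost f l W (\<lambda>i. \<pi> (Suc i)) (f x (\<pi> 0 x) (w 0))"
    unfolding infinite_cost_unfold[of f l \<pi>] by (intro add_mono) auto
  also have "\<dots> \<le> c" using w by (intro assms) auto
  finally show "infinite_cost f l \<pi> w x \<le> c" .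
qed

text \<open>The competing policy applies u once and the optimal law afterwards.\<close>

lemma infinite_value_le_one_step:
  assumes opt: "optimal_law f l U W \<kappa>" and u: "u \<in> U"
    and c: "\<And>w. w \<in> W \<Longrightarrow> ereal (l x u w) + infinite_value f l U W (f x u w) \<le> c"
  shows "infinite_value f l U W x \<le> c"
proof -
  let ?\<pi> = "case_nat (\<lambda>_. u) (\<lambda>_. \<kappa>)"
  have "infinite_value f l U W x \<le> worst_case_cost f l W ?\<pi> x"
    unfolding infinite_value_def using opt u
    by (intro INF_lower) (auto simp: optimal_law_def split: nat.split)
  also have "\<dots> \<le> c"
    using c opt by (intro worst_case_cost_le) (simp add: optimal_law_def)
  finally show ?thesis .
qed

text \<open>The optimal law is stationary, so the cost-to-go after one step is again the optimal value.\<close>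

lemma infinite_value_ge_one_step:
  assumes "optimal_law f l U W \<kappa>" "w \<in> W"
  shows "ereal (l x (\<kappa> x) w) + infinite_value f l U W (f x (\<kappa> x) w) \<le> infinite_value f l U W x"
  using worst_case_cost_ge[OF assms(2), of l x "\<lambda>_. \<kappa>" f] assms(1) by (simp add: optimal_law_def)

text \<open>A dissipation argument: the accumulated cost never exceeds the drop of V along the trajectory.\<close>

lemma infinite_value_le_storage:
  fixes f :: "'x \<Rightarrow> 'u \<Rightarrow> 'w \<Rightarrow> 'x"
  assumes S: "\<And>x w. x \<in> S \<Longrightarrow> w \<in> W \<Longrightarrow> f x (k x) w \<in> S"
    and k: "\<And>x. x \<in> S \<Longrightarrow> k x \<in> U"
    and decrease: "\<And>x w. x \<in> S \<Longrightarrow> w \<in> W \<Longrightarrow> l x (k x) w + V (f x (k x) w) \<le> V x"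
    and nonneg: "\<And>x. x \<in> S \<Longrightarrow> 0 \<le> V x"
    and x: "x \<in> S"
  shows "infinite_value f l U W x \<le> ereal (V x)"
proof -
  define \<pi> :: "nat \<Rightarrow> 'x \<Rightarrow> 'u" where "\<pi> = (\<lambda>_ y. if y \<in> S then k y else k x)"
  have "infinite_cost f l \<pi> w x \<le> ereal (V x)" if w: "\<forall>i::nat. w i \<in> W" for w
  proof -
    let ?x = "trajectory f \<pi> w x"
    have in_S: "?x n \<in> S" for n
      by (induction n) (use x w S in \<open>auto simp: \<pi>_def\<close>)
    have "(\<Sum>i<n. l (?x i) (\<pi> i (?x i)) (w i)) + V (?x n) \<le> V x" for n
    proof (induction n)
      case (Suc n)
      then show ?case
        using decrease[OF in_S, of "w n" n] w in_S[of n] by (simp add: \<pi>_def)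
    qed simp
    then have "(\<Sum>i<n. l (?x i) (\<pi> i (?x i)) (w i)) \<le> V x" for n
      using nonneg[OF in_S[of n]] by (smt (verit))
    then show ?thesis unfolding infinite_cost_def by (intro Limsup_bounded) simp
  qed
  then have "worst_case_cost f l W \<pi> x \<le> ereal (V x)"
    unfolding worst_case_cost_def by (intro SUP_least) auto
  moreover have "infinite_value f l U W x \<le> worst_case_cost f l W \<pi> x"
    unfolding infinite_value_def using k x by (intro INF_lower) (auto simp: \<pi>_def)
  ultimately show ?thesis by (rule order_trans[rotated])
qed

text \<open>The disturbance is chosen open loop, as \<open>k\<close> evaluated along the orbit of y under a, while the
actual state z is driven by an arbitrary policy.  Each step preserves the tangent bound, and after n
steps the bound e is incurred at the current point of the orbit.\<close>

lemma worst_case_cost_ge_tangent: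
  fixes S :: "'y set" and l :: "'x \<Rightarrow> 'u \<Rightarrow> 'w \<Rightarrow> real"
  assumes S: "\<And>y. y \<in> S \<Longrightarrow> a y \<in> S" "\<And>y. y \<in> S \<Longrightarrow> k y \<in> W"
    and step: "\<And>y z u. y \<in> S \<Longrightarrow> \<tau> y z \<le> l z u (k y) + \<tau> (a y) (f z u (k y))"
    and base: "\<And>y z \<pi>. y \<in> S \<Longrightarrow> ereal (\<tau> y z - e y) \<le> worst_case_cost f l W \<pi> z"
    and y: "y \<in> S"
  shows "ereal (\<tau> y z - e ((a ^^ n) y)) \<le> worst_case_cost f l W \<pi> z"
  using y
proof (induction n arbitrary: y z \<pi>)
  case (Suc n)
  let ?z = "f z (\<pi> 0 z) (k y)"
  have "ereal (\<tau> y z - e ((a ^^ Suc n) y))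
      \<le> ereal (l z (\<pi> 0 z) (k y)) + ereal (\<tau> (a y) ?z - e ((a ^^ n) (a y)))"
    using step[OF Suc.prems, of z "\<pi> 0 z"] by (simp add: funpow_swap1)
  also have "\<dots> \<le> ereal (l z (\<pi> 0 z) (k y)) + worst_case_cost f l W (\<lambda>i. \<pi> (Suc i)) ?z"
    by (intro add_left_mono Suc.IH S(1) Suc.prems)
  also have "\<dots> \<le> worst_case_cost f l W \<pi> z"
    by (rule worst_case_cost_ge) (rule S(2)[OF Suc.prems])
  finally show ?case .
qed (simp add: base)


section \<open>Powers of a stable matrix\<close>

text \<open>A scalar contraction driven by an input that tends to zero.  It bounds the component of a linear
recursion that belongs to an eigenvalue inside the unit disc.\<close>

lemma contraction_with_vanishing_input:
  fixes b e :: "nat \<Rightarrow> real"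
  assumes rec: "\<And>n. b (Suc n) \<le> r * b n + e n" and b: "\<And>n. 0 \<le> b n"
    and r: "0 \<le> r" "r < 1" and e: "e \<longlonglongrightarrow> 0"
  shows "b \<longlonglongrightarrow> 0"
proof (rule LIMSEQ_I)
  fix \<epsilon> :: real assume \<epsilon>: "0 < \<epsilon>"
  define d where "d = (1 - r) * (\<epsilon> / 2)"
  have "0 < d" using r \<epsilon> by (simp add: d_def)
  then obtain N where N: "\<And>n. N \<le> n \<Longrightarrow> e n < d"
    using order_tendstoD(2)[OF e, of d] unfolding eventually_sequentially by blast
  have bound: "b (N + k) \<le> r ^ k * b N + \<epsilon> / 2" for k
  proof (induction k)
    case (Suc k)
    have "b (N + Suc k) \<le> r * b (N + k) + d" using rec[of "N + k"] N[of "N + k"] by simp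
    also have "\<dots> \<le> r * (r ^ k * b N + \<epsilon> / 2) + d"
      using Suc r by (intro add_right_mono mult_left_mono) auto
    also have "\<dots> = r ^ Suc k * b N + \<epsilon> / 2" by (simp add: d_def field_simps)
    finally show ?case .
  qed (use \<epsilon> in simp)
  have "(\<lambda>k. r ^ k * b N) \<longlonglongrightarrow> 0 * b N"
    by (intro tendsto_mult_right LIMSEQ_power_zero) (use r in simp)
  then obtain K where K: "\<And>k. K \<le> k \<Longrightarrow> r ^ k * b N < \<epsilon> / 2"
    using order_tendstoD(2)[of _ "0 * b N" sequentially "\<epsilon> / 2"] \<epsilon>
    unfolding eventually_sequentially by auto
  have "norm (b n - 0) < \<epsilon>" if "N + K \<le> n" for n
  proof -
    have "K \<le> n - N" "N + (n - N) = n" using that by auto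
    then show ?thesis using bound[of "n - N"] K[of "n - N"] b[of n] by simp
  qed
  then show "\<exists>n0. \<forall>n\<ge>n0. norm (b n - 0) < \<epsilon>" by blast
qed

lemma norm_vector_smult: "norm (c *s v) = cmod c * norm v" for v :: "complex^'n"
  unfolding norm_vec_def by (simp add: norm_mult L2_set_right_distrib)

lemma scaleR_eq_vector_smult: "a *\<^sub>R v = complex_of_real a *s v" for v :: "complex^'n"
  unfolding vec_eq_iff vector_scaleR_component vector_smult_component by (simp add: scaleR_conv_of_real)

lemma matrix_vector_mult_smult: "T *v (c *s v) = c *s (T *v v)" for T :: "complex^'n^'m"
  by (simp add: vec_eq_iff matrix_vector_mult_def sum_distrib_left mult_ac)

text \<open>This is \<open>p(T) v\<close>, with p(T) the value of p at the matrix T.\<close>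

definition poly_action :: "complex^'n^'n \<Rightarrow> complex poly \<Rightarrow> complex^'n \<Rightarrow> complex^'n" where
  "poly_action T p v = (\<Sum>i\<le>degree p. coeff p i *s (((*v) T ^^ i) v))"

lemma poly_action_bound:
  "degree p \<le> n \<Longrightarrow> poly_action T p v = (\<Sum>i\<le>n. coeff p i *s (((*v) T ^^ i) v))"
  unfolding poly_action_def
  by (rule sum.mono_neutral_left) (auto simp: not_le coeff_eq_0)

lemma poly_action_add: "poly_action T (p + q) v = poly_action T p v + poly_action T q v"
proof -
  let ?n = "max (degree p) (degree q)"
  show ?thesis
    using degree_add_le_max[of p q]
    by (simp add: poly_action_bound[of _ ?n] vector_sadd_rdistrib sum.distrib)
qed

lemma poly_action_0: "poly_action T 0 v = 0"
  by (simp add: poly_action_def)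

lemma poly_action_monom: "poly_action T (monom c i) v = c *s (((*v) T ^^ i) v)"
proof -
  have "poly_action T (monom c i) v = (\<Sum>j\<le>i. coeff (monom c i) j *s (((*v) T ^^ j) v))"
    by (rule poly_action_bound) (rule degree_monom_le)
  also have "\<dots> = (\<Sum>j\<in>{i}. coeff (monom c i) j *s (((*v) T ^^ j) v))"
    by (rule sum.mono_neutral_right) auto
  finally show ?thesis by simp
qed

lemma poly_action_sum: "poly_action T (\<Sum>i\<in>I. p i) v = (\<Sum>i\<in>I. poly_action T (p i) v)"
  by (induction I rule: infinite_finite_induct) (simp_all add: poly_action_0 poly_action_add)

lemma matrix_power_diff:
  "((*v) T ^^ i) (v - w) = ((*v) T ^^ i) v - ((*v) T ^^ i) w" for T :: "complex^'n^'n"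
  by (induction i) (simp_all add: matrix_vector_mult_diff_distrib)

lemma matrix_power_smult:
  "((*v) T ^^ i) (c *s v) = c *s (((*v) T ^^ i) v)" for T :: "complex^'n^'n"
  by (induction i) (simp_all add: matrix_vector_mult_smult)

lemma poly_action_linear_factor:
  "poly_action T ([:- z, 1:] * q) v = poly_action T q (T *v v - z *s v)"
proof -
  let ?n = "degree q"
  have "degree ([:- z, 1:] * q) \<le> Suc ?n"
    using degree_mult_le[of "[:- z, 1:]" q] by simp
  then have "poly_action T ([:- z, 1:] * q) v
      = (\<Sum>i\<le>Suc ?n. coeff ([:- z, 1:] * q) i *s (((*v) T ^^ i) v))"
    by (rule poly_action_bound)
  also have "\<dots> = (\<Sum>i\<le>Suc ?n. coeff (pCons 0 q) i *s (((*v) T ^^ i) v))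
      - (\<Sum>i\<le>Suc ?n. (z * coeff q i) *s (((*v) T ^^ i) v))"
    unfolding sum_subtractf[symmetric] vector_sub_rdistrib[symmetric] by simp
  also have "(\<Sum>i\<le>Suc ?n. coeff (pCons 0 q) i *s (((*v) T ^^ i) v))
      = (\<Sum>i\<le>?n. coeff q i *s (((*v) T ^^ i) (T *v v)))"
    unfolding sum.atMost_Suc_shift funpow_Suc_right by simp
  also have "(\<Sum>i\<le>Suc ?n. (z * coeff q i) *s (((*v) T ^^ i) v))
      = (\<Sum>i\<le>?n. coeff q i *s (((*v) T ^^ i) (z *s v)))"
    unfolding sum.atMost_Suc matrix_power_smult
    by (simp add: coeff_eq_0 vector_smult_assoc mult.commute)
  also have "(\<Sum>i\<le>?n. coeff q i *s (((*v) T ^^ i) (T *v v))) - \<dots>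
      = poly_action T q (T *v v - z *s v)"
    by (simp add: poly_action_def matrix_power_diff vector_ssub_ldistrib sum_subtractf)
  finally show ?thesis .
qed

text \<open>\<open>DIM + 1\<close> iterates of v are linearly dependent over the reals (or two of them coincide), and the
coefficients of the relation form the polynomial.\<close>

lemma poly_action_annihilator: "\<exists>p. p \<noteq> 0 \<and> poly_action T p v = 0" for v :: "complex^'n"
proof -
  define N where "N = DIM(complex^'n)"
  let ?o = "\<lambda>i. ((*v) T ^^ i) v"
  show ?thesis
  proof (cases "inj_on ?o {..N}")
    case False
    then obtain i j where ij: "i \<noteq> j" "?o i = ?o j" unfolding inj_on_def by blast
    let ?p = "monom 1 i + monom (-1) j :: complex poly"
    have "coeff ?p i = 1" using ij by simp
    then have "?p \<noteq> 0" by (metis coeff_0 zero_neq_one)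
    moreover have "poly_action T ?p v = 0"
      using ij by (simp add: poly_action_add poly_action_monom vector_smult_lneg)
    ultimately show ?thesis by blast
  next
    case True
    let ?S = "?o ` {..N}"
    have "card ?S > DIM(complex^'n)" using True by (simp add: card_image N_def)
    then have "dependent ?S" using independent_bound by (metis not_le)
    then obtain a where a: "\<exists>y\<in>?S. a y \<noteq> 0" "(\<Sum>y\<in>?S. a y *\<^sub>R y) = 0"
      by (auto simp: dependent_finite)
    let ?p = "\<Sum>i\<le>N. monom (complex_of_real (a (?o i))) i"
    obtain i where i: "i \<le> N" "a (?o i) \<noteq> 0" using a(1) by blast
    have "coeff ?p i = complex_of_real (a (?o i))"
      using i by (simp add: coeff_sum)
    then have "?p \<noteq> 0" using i by (metis coeff_0 of_real_eq_0_iff)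
    moreover have "poly_action T ?p v = 0"
      using a(2) by (simp add: poly_action_sum poly_action_monom sum.reindex[OF True]
          scaleR_eq_vector_smult)
    ultimately show ?thesis by blast
  qed
qed

text \<open>A polynomial that annihilates v is split into linear factors, and the
factors are removed one at a time: if the iterates of \<open>T v - z v\<close> tend to zero, then so do those of v.
When z lies inside the unit disc they satisfy a contraction with vanishing input; otherwise z is
not an eigenvalue and \<open>T - z\<close> is bounded below.\<close>

lemma complex_stable_powers_tendsto_0:
  fixes T :: "complex^'n^'n"
  assumes stable: "\<And>z v. v \<noteq> 0 \<Longrightarrow> T *v v = z *s v \<Longrightarrow> cmod z < 1"
  shows "(\<lambda>n. ((*v) T ^^ n) v) \<longlonglongrightarrow> 0"
proof -
  have "(\<lambda>n. ((*v) T ^^ n) v) \<longlonglongrightarrow> 0" if "p \<noteq> 0" "poly_action T p v = 0" for p v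
    using that
  proof (induction "degree p" arbitrary: p v)
    case 0
    then obtain c where "p = [:c:]" by (metis degree_eq_zeroE)
    then have "v = 0" using 0 by (simp add: poly_action_def)
    moreover have "((*v) T ^^ n) 0 = 0" for n by (induction n) simp_all
    ultimately show ?case by simp
  next
    case (Suc d)
    have "\<not> constant (poly p)" using Suc.hyps(2) by (simp add: constant_degree)
    then obtain z where "poly p z = 0" using fundamental_theorem_of_algebra by blast
    then obtain q where q: "p = [:- z, 1:] * q" unfolding poly_eq_0_iff_dvd dvd_def by blast
    have q0: "q \<noteq> 0" using Suc.prems q by auto
    then have "degree p = Suc (degree q)" unfolding q by (subst degree_mult_eq) auto
    then have d: "d = degree q" using Suc.hyps(2) by simp
    let ?L = "\<lambda>y. T *v y - z *s y"
    have IH: "(\<lambda>n. ((*v) T ^^ n) (?L v)) \<longlonglongrightarrow> 0"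
      using Suc.hyps(1)[OF d q0] Suc.prems(2) unfolding q poly_action_linear_factor by blast
    have commute: "?L (((*v) T ^^ n) v) = ((*v) T ^^ n) (?L v)" for n
      unfolding matrix_power_diff matrix_power_smult funpow_swap1 ..
    show ?case
    proof (cases "cmod z < 1")
      case True
      have "norm (((*v) T ^^ Suc n) v) \<le> cmod z * norm (((*v) T ^^ n) v) + norm (((*v) T ^^ n) (?L v))"
        for n
      proof -
        have "((*v) T ^^ Suc n) v = z *s (((*v) T ^^ n) v) + ((*v) T ^^ n) (?L v)"
          unfolding commute[symmetric] by simp
        then show ?thesis by (metis norm_triangle_ineq norm_vector_smult)
      qed
      then have "(\<lambda>n. norm (((*v) T ^^ n) v)) \<longlonglongrightarrow> 0"
        by (rule contraction_with_vanishing_input)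
           (use True tendsto_norm_zero[OF IH] in auto)
      then show ?thesis by (rule tendsto_norm_zero_cancel)
    next
      case False
      have lin: "linear ?L"
        by (rule linearI)
          (simp_all add: matrix_vector_right_distrib vector_add_ldistrib scaleR_eq_vector_smult
            matrix_vector_mult_smult vector_ssub_ldistrib vector_smult_assoc mult.commute)
      have "inj ?L"
        unfolding linear_injective_0[OF lin] using stable False by auto
      then obtain B where B: "0 < B" "\<And>y. B * norm y \<le> norm (?L y)"
        using linear_inj_bounded_below_pos[OF lin] by blast
      have le: "norm (((*v) T ^^ n) v) \<le> norm (((*v) T ^^ n) (?L v)) / B" for n
        using B(2)[of "((*v) T ^^ n) v"] B(1) unfolding commute by (simp add: field_simps)
      have "(\<lambda>n. norm (((*v) T ^^ n) (?L v)) / B) \<longlonglongrightarrow> 0 / B"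
        by (intro tendsto_divide tendsto_norm_zero[OF IH] tendsto_const) (use B in simp)
      then show ?thesis
        by (intro Lim_null_comparison[OF always_eventually[OF allI[OF le]]]) simp
    qed
  qed
  then show ?thesis using poly_action_annihilator by blast
qed

text \<open>Stability refers to complex eigenvalues, so the orbit is embedded isometrically into complex
vectors.\<close>

lemma stable_powers_tendsto_0:
  fixes M :: "real^'n^'n"
  assumes "stable_matrix M"
  shows "(\<lambda>n. ((*v) M ^^ n) x) \<longlonglongrightarrow> 0"
proof -
  let ?c = "\<lambda>x::real^'n. (\<chi> i. complex_of_real (x $ i))"
  have step: "cmatrix M *v ?c x = ?c (M *v x)" for x
    by (simp add: vec_eq_iff cmatrix_def matrix_vector_mult_def)
  have power: "((*v) (cmatrix M) ^^ n) (?c x) = ?c (((*v) M ^^ n) x)" for n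
    by (induction n) (simp_all add: step)
  have norm: "norm (?c x) = norm x" for x
    by (simp add: norm_vec_def)
  have "(\<lambda>n. ((*v) (cmatrix M) ^^ n) (?c x)) \<longlonglongrightarrow> 0"
    using assms by (intro complex_stable_powers_tendsto_0) (auto simp: stable_matrix_def)
  then have "(\<lambda>n. norm (((*v) M ^^ n) x)) \<longlonglongrightarrow> 0"
    unfolding power by (auto dest: tendsto_norm_zero simp: norm)
  then show ?thesis by (rule tendsto_norm_zero_cancel)
qed

section \<open>Quadratic forms and the Riccati equation\<close>

lemma inner_matrix_vector_transpose: "x \<bullet> (A *v y) = (transpose A *v x) \<bullet> y"
  for A :: "real^'n^'m"
  by (simp add: dot_lmul_matrix)

lemma pos_def_sym: "pos_def M \<Longrightarrow> x \<bullet> (M *v y) = y \<bullet> (M *v x)"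
  by (metis inner_commute inner_matrix_vector_transpose pos_def_def)

lemma pos_def_nonneg: "pos_def M \<Longrightarrow> 0 \<le> x \<bullet> (M *v x)"
  unfolding pos_def_def by (cases "x = 0") (auto simp: less_imp_le)

lemma pos_def_eq_0: "pos_def M \<Longrightarrow> x \<bullet> (M *v x) \<le> 0 \<Longrightarrow> x = 0"
  unfolding pos_def_def by (metis not_less)

lemma matrix_inv_mult_vector:
  fixes M :: "real^'n^'n"
  assumes "\<And>x. M *v x = 0 \<Longrightarrow> x = 0"
  shows "M *v (matrix_inv M *v y) = y"
proof -
  have "\<exists>N. N ** M = mat 1" unfolding matrix_left_invertible_ker using assms by blast
  then have "invertible M" using invertible_left_inverse by blast
  then have "M ** matrix_inv M = mat 1"
    unfolding invertible_def matrix_inv_def by (metis (mono_tags, lifting) someI_ex)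
  then show ?thesis by (simp add: matrix_vector_mul_assoc)
qed

lemma pos_def_inv:
  assumes "pos_def M"
  shows pos_def_mult_inv: "M *v (matrix_inv M *v y) = y"
    and pos_def_inv_nonneg: "0 \<le> y \<bullet> (matrix_inv M *v y)"
proof -
  show M: "M *v (matrix_inv M *v y) = y"
    by (rule matrix_inv_mult_vector) (use pos_def_eq_0[OF assms] in auto)
  show "0 \<le> y \<bullet> (matrix_inv M *v y)"
    using pos_def_nonneg[OF assms, of "matrix_inv M *v y"] by (simp add: M inner_commute)
qed

lemma pos_def_coercive:
  fixes M :: "real^'n^'n"
  assumes "pos_def M"
  obtains q where "0 < q" "\<And>x. q * (norm x)\<^sup>2 \<le> x \<bullet> (M *v x)"
proof -
  have cont: "continuous_on (sphere 0 1) (\<lambda>x. x \<bullet> (M *v x))"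
    by (intro continuous_intros bounded_linear.continuous_on[OF matrix_vector_mul_bounded_linear])
  have nonempty: "sphere (0::real^'n) 1 \<noteq> {}" by simp
  obtain y where y: "y \<in> sphere 0 1" "\<And>x. x \<in> sphere 0 1 \<Longrightarrow> y \<bullet> (M *v y) \<le> x \<bullet> (M *v x)"
    using continuous_attains_inf[OF compact_sphere nonempty cont] by blast
  have "y \<bullet> (M *v y) * (norm x)\<^sup>2 \<le> x \<bullet> (M *v x)" for x
  proof (cases "x = 0")
    case False
    define s where "s = (1 / norm x) *\<^sub>R x"
    have s: "s \<in> sphere 0 1" "norm x *\<^sub>R s = x" using False by (simp_all add: s_def)
    have "y \<bullet> (M *v y) * (norm x)\<^sup>2 \<le> s \<bullet> (M *v s) * (norm x)\<^sup>2"
      by (intro mult_right_mono y(2) s(1)) simp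
    also have "s \<bullet> (M *v s) * (norm x)\<^sup>2 = (norm x *\<^sub>R s) \<bullet> (M *v (norm x *\<^sub>R s))"
      unfolding matrix_vector_mult_scaleR inner_scaleR_left inner_scaleR_right power2_eq_square
      by (simp only: ac_simps)
    finally show ?thesis unfolding s(2) .
  qed simp
  moreover have "y \<noteq> 0" using y(1) by auto
  then have "0 < y \<bullet> (M *v y)" using assms unfolding pos_def_def by blast
  ultimately show thesis using that by blast
qed

lemma pos_def_diff:
  assumes "pos_def M"
  shows "(z - x) \<bullet> (M *v (z - x)) = z \<bullet> (M *v z) - 2 * (x \<bullet> (M *v z)) + x \<bullet> (M *v x)"
  using pos_def_sym[OF assms, of x z]
  by (simp add: matrix_vector_mult_diff_distrib inner_diff_left inner_diff_right)

lemma quadratic_linepath: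
  assumes "pos_def M"
  shows "linepath x z t \<bullet> (M *v linepath x z t) = (1 - t) * (x \<bullet> (M *v x)) + t * (z \<bullet> (M *v z))
    - t * (1 - t) * ((z - x) \<bullet> (M *v (z - x)))"
proof -
  define a b c where "a = x \<bullet> (M *v x)" and "b = x \<bullet> (M *v z)" and "c = z \<bullet> (M *v z)"
  have sym: "z \<bullet> (M *v x) = b" unfolding b_def by (rule pos_def_sym[OF assms])
  have "linepath x z t \<bullet> (M *v linepath x z t)
      = (1 - t) * ((1 - t) * a) + (1 - t) * (t * b) + (t * ((1 - t) * b) + t * (t * c))"
    unfolding linepath_def matrix_vector_right_distrib matrix_vector_mult_scaleR inner_add_left
      inner_add_right inner_scaleR_left inner_scaleR_right sym a_def[symmetric] b_def[symmetric]
      c_def[symmetric] by (simp add: algebra_simps)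
  also have "\<dots> = (1 - t) * a + t * c - t * (1 - t) * (c - 2 * b + a)"
    by (simp add: algebra_simps)
  finally show ?thesis
    unfolding pos_def_diff[OF assms] a_def b_def c_def .
qed

lemma matrix_vector_mult_uminus:
  fixes M :: "real^'n^'m"
  shows matrix_vector_mult_minus_left: "(- M) *v x = - (M *v x)"
    and matrix_vector_mult_minus_right: "M *v (- x) = - (M *v x)"
  by (simp_all add: vec_eq_iff matrix_vector_mult_def sum_negf)

lemma mat_mult_vector: "mat c *v v = c *\<^sub>R v" for v :: "real^'n"
  by (simp add: vec_eq_iff matrix_vector_mult_def mat_def if_distrib[of "\<lambda>a. a * _"] cong: if_cong)

text \<open>The first-order conditions of the unconstrained game, with the costate \<open>P y\<close> at the saddle successor
y.  The matrix M of the inner maximisation satisfies \<open>M s = P y\<close>, where s is the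
successor without disturbance; this is what turns the closed formulas for the gains into these
relations.\<close>

lemma riccati_stationarity:
  fixes A :: "real^'n^'n" and B :: "real^'m^'n" and G :: "real^'p^'n" and x :: "real^'n"
  assumes P: "pos_def P" and R: "pos_def R" and riccati: "hinf_riccati A B G Q R \<gamma> P"
  defines "Ku \<equiv> control_gain A B G R \<gamma> P" and "Kw \<equiv> disturbance_gain A B G R \<gamma> P"
  defines "y \<equiv> linear_plant A B G x (Ku *v x) (Kw *v x)"
  shows riccati_state: "P *v x = Q *v x + transpose A *v (P *v y)"
    and riccati_control: "R *v (Ku *v x) = - (transpose B *v (P *v y))"
    and riccati_disturbance: "\<gamma>\<^sup>2 *\<^sub>R (Kw *v x) = transpose G *v (P *v y)"
proof -
  define S where "S = mat (\<gamma>\<^sup>2) - transpose G ** P ** G"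
  define M where "M = riccati_inner G \<gamma> P"
  define N where "N = R + transpose B ** M ** B"
  define u w s where "u = Ku *v x" and "w = Kw *v x" and "s = A *v x + B *v u"
  have S: "pos_def S" and
    PQ: "P = Q + transpose A ** M ** A
            - transpose A ** M ** B ** matrix_inv N ** transpose B ** M ** A"
    using riccati by (simp_all add: hinf_riccati_def Let_def S_def M_def N_def)
  have PT: "transpose P = P" using P by (simp add: pos_def_def)
  have Mv: "M *v v = P *v (v + G *v (matrix_inv S *v (transpose G *v (P *v v))))" for v
    by (simp add: M_def riccati_inner_def S_def matrix_vector_mult_add_rdistrib
        matrix_vector_right_distrib flip: matrix_vector_mul_assoc)
  have M_nonneg: "0 \<le> v \<bullet> (M *v v)" for v
  proof -
    let ?g = "transpose G *v (P *v v)"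
    have "v \<bullet> (M *v v) = v \<bullet> (P *v v) + ?g \<bullet> (matrix_inv S *v ?g)"
      unfolding Mv matrix_vector_right_distrib inner_add_right
      by (simp only: inner_matrix_vector_transpose[of v P] inner_matrix_vector_transpose[of "P *v v" G] PT)
    then show ?thesis using pos_def_nonneg[OF P] pos_def_inv_nonneg[OF S] by simp
  qed
  have Sv: "S *v v = \<gamma>\<^sup>2 *\<^sub>R v - transpose G *v (P *v (G *v v))" for v
    unfolding S_def matrix_vector_mult_diff_rdistrib matrix_vector_mul_assoc[symmetric]
      mat_mult_vector ..
  have Nv: "N *v v = R *v v + transpose B *v (M *v (B *v v))" for v
    by (simp add: N_def matrix_vector_mult_add_rdistrib flip: matrix_vector_mul_assoc)
  have "N *v v = 0 \<Longrightarrow> v = 0" for v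
  proof -
    assume "N *v v = 0"
    then have "v \<bullet> (R *v v) + v \<bullet> (transpose B *v (M *v (B *v v))) = 0"
      by (simp add: Nv flip: inner_add_right)
    moreover have "v \<bullet> (transpose B *v (M *v (B *v v))) = (B *v v) \<bullet> (M *v (B *v v))"
      by (subst inner_matrix_vector_transpose) simp
    ultimately have "v \<bullet> (R *v v) \<le> 0" using M_nonneg[of "B *v v"] by simp
    then show "v = 0" by (rule pos_def_eq_0[OF R])
  qed
  note N_inv = matrix_inv_mult_vector[OF this]
  have y: "y = s + G *v w" by (simp add: y_def linear_plant_def s_def u_def w_def)
  have u: "u = - (matrix_inv N *v (transpose B *v (M *v (A *v x))))"
    by (simp add: u_def Ku_def control_gain_def Let_def N_def M_def matrix_vector_mult_minus_left
        flip: matrix_vector_mul_assoc)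
  have w: "w = matrix_inv S *v (transpose G *v (P *v s))"
    by (simp add: w_def Kw_def disturbance_gain_def S_def s_def u_def Ku_def
        matrix_vector_mult_add_rdistrib flip: matrix_vector_mul_assoc)
  have "S *v w = transpose G *v (P *v s)" unfolding w by (rule pos_def_mult_inv[OF S])
  then show "\<gamma>\<^sup>2 *\<^sub>R (Kw *v x) = transpose G *v (P *v y)"
    unfolding Sv y w_def[symmetric] by (simp add: matrix_vector_right_distrib algebra_simps)
  have Ms: "M *v s = P *v y" unfolding Mv y w ..
  have "N *v u = - (transpose B *v (M *v (A *v x)))"
    unfolding u by (simp add: N_inv matrix_vector_mult_minus_right)
  then have "R *v u = - (transpose B *v (M *v s))"
    unfolding Nv s_def matrix_vector_right_distrib eq_neg_iff_add_eq_0
    by (simp only: eq_neg_iff_add_eq_0 add_ac)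
  then show "R *v (Ku *v x) = - (transpose B *v (P *v y))" by (simp only: Ms u_def)
  have "P *v x = Q *v x + transpose A *v (M *v (A *v x))
      - transpose A *v (M *v (B *v (matrix_inv N *v (transpose B *v (M *v (A *v x))))))"
    using arg_cong[OF PQ, of "\<lambda>X. X *v x"]
    by (simp only: matrix_vector_mult_add_rdistrib matrix_vector_mult_diff_rdistrib
        matrix_vector_mul_assoc[symmetric])
  also have "\<dots> = Q *v x + transpose A *v (M *v s)"
    unfolding s_def u matrix_vector_right_distrib matrix_vector_mult_minus_right by simp
  finally show "P *v x = Q *v x + transpose A *v (P *v y)" by (simp only: Ms)
qed

text \<open>The tangent at x of \<open>z \<mapsto> 1/2 z'Pz\<close>.\<close>

definition tangent :: "real^'n^'n \<Rightarrow> real^'n \<Rightarrow> real^'n \<Rightarrow> real" where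
  "tangent P x z = x \<bullet> (P *v z) - 1/2 * (x \<bullet> (P *v x))"

text \<open>Completion of squares around the saddle point.  By stationarity the linear terms in z - x and
u - Ku x cancel, which leaves the squares in the first part.  In the second part, deviating
from \<open>Kw x\<close> by d adds \<open>-1/2 d'(\<gamma>\<^sup>2I - G'PG)d\<close>, which the Riccati hypothesis makes nonpositive.\<close>

lemma riccati_saddle:
  fixes A :: "real^'n^'n" and B :: "real^'m^'n" and G :: "real^'p^'n" and x :: "real^'n"
  assumes P: "pos_def P" and Q: "pos_def Q" and R: "pos_def R"
    and riccati: "hinf_riccati A B G Q R \<gamma> P"
  defines "Ku \<equiv> control_gain A B G R \<gamma> P" and "Kw \<equiv> disturbance_gain A B G R \<gamma> P"
  defines "y \<equiv> linear_plant A B G x (Ku *v x) (Kw *v x)"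
  shows riccati_saddle_control: "stage_cost Q R \<gamma> z u (Kw *v x)
      + tangent P y (linear_plant A B G z u (Kw *v x))
    = tangent P x z + 1/2 * ((z - x) \<bullet> (Q *v (z - x)))
      + 1/2 * ((u - Ku *v x) \<bullet> (R *v (u - Ku *v x)))"
    and riccati_saddle_disturbance: "stage_cost Q R \<gamma> x (Ku *v x) v
      + 1/2 * (linear_plant A B G x (Ku *v x) v \<bullet> (P *v linear_plant A B G x (Ku *v x) v))
    \<le> 1/2 * (x \<bullet> (P *v x))"
proof -
  note stat = riccati_stationarity[OF P R riccati, of x, folded Ku_def Kw_def, folded y_def]
  define k w where "k = Ku *v x" and "w = Kw *v x"
  have PT: "transpose P = P" using P by (simp add: pos_def_def)
  have costate: "y \<bullet> (P *v linear_plant A B G z u v)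
      = x \<bullet> (P *v z) - x \<bullet> (Q *v z) - k \<bullet> (R *v u) + \<gamma>\<^sup>2 * (w \<bullet> v)" for z u v
  proof -
    have "y \<bullet> (P *v linear_plant A B G z u v) = (P *v y) \<bullet> (A *v z + B *v u + G *v v)"
      by (simp only: inner_matrix_vector_transpose[of y P] PT linear_plant_def)
    also have "\<dots> = (transpose A *v (P *v y)) \<bullet> z + (transpose B *v (P *v y)) \<bullet> u
        + (transpose G *v (P *v y)) \<bullet> v"
      by (simp only: inner_add_right inner_matrix_vector_transpose[of _ A]
          inner_matrix_vector_transpose[of _ B] inner_matrix_vector_transpose[of _ G])
    also have "transpose A *v (P *v y) = P *v x - Q *v x" using stat(1) by (simp add: algebra_simps)
    also have "transpose B *v (P *v y) = - (R *v k)" using stat(2) by (simp add: k_def)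
    also have "transpose G *v (P *v y) = \<gamma>\<^sup>2 *\<^sub>R w" using stat(3) by (simp add: w_def)
    also have "(P *v x - Q *v x) \<bullet> z + - (R *v k) \<bullet> u + \<gamma>\<^sup>2 *\<^sub>R w \<bullet> v
        = x \<bullet> (P *v z) - x \<bullet> (Q *v z) - k \<bullet> (R *v u) + \<gamma>\<^sup>2 * (w \<bullet> v)"
      using pos_def_sym[OF P, of x z] pos_def_sym[OF Q, of x z] pos_def_sym[OF R, of k u]
      by (simp add: inner_diff_right inner_commute)
    finally show ?thesis .
  qed
  have yy: "y \<bullet> (P *v y) = x \<bullet> (P *v x) - x \<bullet> (Q *v x) - k \<bullet> (R *v k) + \<gamma>\<^sup>2 * (w \<bullet> w)"
    using costate[of x k w] by (simp add: y_def k_def w_def)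
  have "tangent P y (linear_plant A B G z u w) = x \<bullet> (P *v z) - x \<bullet> (Q *v z) - k \<bullet> (R *v u)
      + \<gamma>\<^sup>2 * (w \<bullet> w) - 1/2 * (x \<bullet> (P *v x) - x \<bullet> (Q *v x) - k \<bullet> (R *v k) + \<gamma>\<^sup>2 * (w \<bullet> w))"
    by (simp only: tangent_def costate yy)
  moreover have "stage_cost Q R \<gamma> z u w
      = 1/2 * (z \<bullet> (Q *v z)) + 1/2 * (u \<bullet> (R *v u)) - 1/2 * (\<gamma>\<^sup>2 * (w \<bullet> w))"
    unfolding stage_cost_def power2_norm_eq_inner by simp
  ultimately have "stage_cost Q R \<gamma> z u w + tangent P y (linear_plant A B G z u w)
    = tangent P x z + 1/2 * ((z - x) \<bullet> (Q *v (z - x))) + 1/2 * ((u - k) \<bullet> (R *v (u - k)))"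
    unfolding pos_def_diff[OF Q, of z x] pos_def_diff[OF R, of u k] tangent_def[of P x]
    by (simp add: algebra_simps)
  then show "stage_cost Q R \<gamma> z u (Kw *v x) + tangent P y (linear_plant A B G z u (Kw *v x))
    = tangent P x z + 1/2 * ((z - x) \<bullet> (Q *v (z - x)))
      + 1/2 * ((u - Ku *v x) \<bullet> (R *v (u - Ku *v x)))"
    by (simp only: k_def w_def)
  define y' d where "y' = linear_plant A B G x k v" and "d = v - w"
  have "y' - y = G *v d"
    by (simp add: y'_def d_def y_def k_def w_def linear_plant_def matrix_vector_mult_diff_distrib)
  then have "(G *v d) \<bullet> (P *v (G *v d)) = y' \<bullet> (P *v y') - 2 * (y \<bullet> (P *v y')) + y \<bullet> (P *v y)"
    using pos_def_diff[OF P, of y' y] by (simp only:)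
  moreover have "y \<bullet> (P *v y') = x \<bullet> (P *v x) - x \<bullet> (Q *v x) - k \<bullet> (R *v k) + \<gamma>\<^sup>2 * (w \<bullet> v)"
    unfolding y'_def by (rule costate)
  moreover have "(G *v d) \<bullet> (P *v (G *v d)) \<le> \<gamma>\<^sup>2 * (d \<bullet> d)"
  proof -
    have "pos_def (mat (\<gamma>\<^sup>2) - transpose G ** P ** G)"
      using riccati by (simp add: hinf_riccati_def)
    from pos_def_nonneg[OF this, of d]
    have "0 \<le> \<gamma>\<^sup>2 * (d \<bullet> d) - d \<bullet> (transpose G *v (P *v (G *v d)))"
      by (simp only: matrix_vector_mult_diff_rdistrib inner_diff_right mat_mult_vector
          inner_scaleR_right matrix_vector_mul_assoc[symmetric])
    then show ?thesis
      by (simp only: inner_matrix_vector_transpose[of d "transpose G"] transpose_transpose)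
  qed
  moreover have "\<gamma>\<^sup>2 * (d \<bullet> d) = \<gamma>\<^sup>2 * (v \<bullet> v) - 2 * (\<gamma>\<^sup>2 * (w \<bullet> v)) + \<gamma>\<^sup>2 * (w \<bullet> w)"
    unfolding d_def by (simp add: inner_diff_left inner_diff_right inner_commute algebra_simps)
  moreover have "stage_cost Q R \<gamma> x k v
      = 1/2 * (x \<bullet> (Q *v x)) + 1/2 * (k \<bullet> (R *v k)) - 1/2 * (\<gamma>\<^sup>2 * (v \<bullet> v))"
    unfolding stage_cost_def power2_norm_eq_inner by simp
  ultimately have "stage_cost Q R \<gamma> x k v + 1/2 * (y' \<bullet> (P *v y')) \<le> 1/2 * (x \<bullet> (P *v x))"
    using yy by linarith
  then show "stage_cost Q R \<gamma> x (Ku *v x) v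
      + 1/2 * (linear_plant A B G x (Ku *v x) v \<bullet> (P *v linear_plant A B G x (Ku *v x) v))
    \<le> 1/2 * (x \<bullet> (P *v x))"
    by (simp only: y'_def k_def)
qed

section \<open>The constrained linear-quadratic game\<close>

lemma continuous_on_matrix_vector_mult:
  "continuous_on S g \<Longrightarrow> continuous_on S (\<lambda>x. M *v g x)" for M :: "real^'n^'m"
  by (rule bounded_linear.continuous_on[OF matrix_vector_mul_bounded_linear])

lemma linear_plant_linepath:
  "linear_plant A B G (linepath x z t) (linepath u v t) w
    = linepath (linear_plant A B G x u w) (linear_plant A B G z v w) t"
proof -
  have w: "G *v w = (1 - t) *\<^sub>R (G *v w) + t *\<^sub>R (G *v w)"
    by (simp flip: scaleR_left_distrib)
  show ?thesis
    unfolding linear_plant_def linepath_def matrix_vector_right_distrib matrix_vector_mult_scaleR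
      scaleR_right_distrib
    by (subst w) (simp only: ac_simps)
qed

lemma linear_quadratic_convex_game:
  assumes Q: "pos_def Q" and R: "pos_def R"
    and U: "polytope U" "U \<noteq> {}" and W: "polytope W" "W \<noteq> {}"
  shows "convex_game (linear_plant A B G) (stage_cost Q R \<gamma>) U W (\<lambda>d. 1/2 * (d \<bullet> (R *v d)))"
proof
  show "linear_plant A B G (linepath x z t) (linepath u v t) w
    = linepath (linear_plant A B G x u w) (linear_plant A B G z v w) t" for x z t u v w
    by (rule linear_plant_linepath)
  show "continuous_on UNIV (\<lambda>(x, u, w). linear_plant A B G x u w)"
    unfolding linear_plant_def case_prod_beta
    by (intro continuous_intros continuous_on_matrix_vector_mult)
  show "continuous_on UNIV (\<lambda>(x, u, w). stage_cost Q R \<gamma> x u w)"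
    unfolding stage_cost_def case_prod_beta
    by (intro continuous_intros continuous_on_matrix_vector_mult)
  show "stage_cost Q R \<gamma> (linepath x z t) (linepath u v t) w
        \<le> (1 - t) * stage_cost Q R \<gamma> x u w + t * stage_cost Q R \<gamma> z v w
          - t * (1 - t) * (1/2 * ((v - u) \<bullet> (R *v (v - u))))"
    if "0 \<le> t" "t \<le> 1" for t x z u v w
  proof -
    define dQ dR where "dQ = (z - x) \<bullet> (Q *v (z - x))" and "dR = (v - u) \<bullet> (R *v (v - u))"
    have "0 \<le> t * (1 - t) * dQ"
      using that pos_def_nonneg[OF Q] by (simp add: dQ_def)
    then show ?thesis
      unfolding stage_cost_def quadratic_linepath[OF Q] quadratic_linepath[OF R]
        dQ_def[symmetric] dR_def[symmetric]
      by (simp add: field_simps)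
  qed
  show "0 \<le> 1/2 * (d \<bullet> (R *v d))" for d using pos_def_nonneg[OF R] by simp
  show "d = 0" if "1/2 * (d \<bullet> (R *v d)) \<le> 0" for d
    using that by (intro pos_def_eq_0[OF R]) simp
qed (use U W in \<open>auto intro: polytope_imp_compact polytope_imp_convex\<close>)

lemma tangent_remainder:
  assumes "pos_def P"
  shows "1/2 * (z \<bullet> (P *v z)) = tangent P x z + 1/2 * ((z - x) \<bullet> (P *v (z - x)))"
  unfolding pos_def_diff[OF assms] tangent_def by (simp add: field_simps)

lemma convex_quadratic:
  assumes "pos_def P"
  shows "convex_on UNIV (\<lambda>x. 1/2 * (x \<bullet> (P *v x)))"
proof (rule convex_onI)
  fix t :: real and x z
  assume t: "0 < t" "t < 1"
  then have "0 \<le> t * (1 - t) * ((z - x) \<bullet> (P *v (z - x)))"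
    using pos_def_nonneg[OF assms] by simp
  then show "1/2 * (((1 - t) *\<^sub>R x + t *\<^sub>R z) \<bullet> (P *v ((1 - t) *\<^sub>R x + t *\<^sub>R z)))
      \<le> (1 - t) * (1/2 * (x \<bullet> (P *v x))) + t * (1/2 * (z \<bullet> (P *v z)))"
    using quadratic_linepath[OF assms, of x z t] by (simp add: linepath_def)
qed auto

lemma quadratic_secant:
  assumes "pos_def P" "0 < e"
  shows "\<forall>\<^sub>F t in at_right 0. 1/2 * (linepath x z t \<bullet> (P *v linepath x z t))
    \<le> (1 - t) * (1/2 * (x \<bullet> (P *v x))) + t * (tangent P x z + e)"
proof -
  let ?d = "1/2 * ((z - x) \<bullet> (P *v (z - x)))"
  have "((\<lambda>t. t * ?d) \<longlongrightarrow> 0 * ?d) (at_right 0)"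
    by (intro tendsto_intros)
  then have "\<forall>\<^sub>F t in at_right 0. t * ?d < e"
    by (rule order_tendstoD) (use assms in simp)
  then show ?thesis
    using eventually_at_right_less[of "0::real"]
  proof eventually_elim
    case (elim t)
    have "1/2 * (linepath x z t \<bullet> (P *v linepath x z t))
        = (1 - t) * (1/2 * (x \<bullet> (P *v x))) + t * (1/2 * (z \<bullet> (P *v z))) - t * (1 - t) * ?d"
      unfolding quadratic_linepath[OF assms(1)] by simp
    also have "\<dots> = (1 - t) * (1/2 * (x \<bullet> (P *v x))) + t * (tangent P x z + t * ?d)"
      unfolding tangent_remainder[OF assms(1), of z x] by (simp only: ring_distribs)
    also have "\<dots> \<le> (1 - t) * (1/2 * (x \<bullet> (P *v x))) + t * (tangent P x z + e)"
      using elim by (intro add_left_mono mult_left_mono) auto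
    finally show ?case .
  qed
qed

text \<open>The zero disturbance makes all stage costs nonnegative, so the first one is a lower bound.\<close>

lemma worst_case_cost_ge_quadratic:
  fixes G :: "real^'p^'n"
  assumes Q: "pos_def Q" and R: "pos_def R" and W: "0 \<in> W"
  shows "ereal (1/2 * (z \<bullet> (Q *v z)))
    \<le> worst_case_cost (linear_plant A B G) (stage_cost Q R \<gamma>) W \<pi> z"
proof -
  have nonneg: "0 \<le> stage_cost Q R \<gamma> x u 0" for x u
    using pos_def_nonneg[OF Q] pos_def_nonneg[OF R] by (simp add: stage_cost_def)
  have cost_nonneg: "0 \<le> infinite_cost (linear_plant A B G) (stage_cost Q R \<gamma>) \<pi> (\<lambda>_. 0) x" for \<pi> x
  proof -
    have "limsup (\<lambda>_::nat. 0::ereal) \<le> infinite_cost (linear_plant A B G) (stage_cost Q R \<gamma>) \<pi> (\<lambda>_. 0) x"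
      unfolding infinite_cost_def by (intro Limsup_mono always_eventually allI) (simp add: sum_nonneg nonneg)
    then show ?thesis by (simp add: Limsup_const)
  qed
  have "ereal (stage_cost Q R \<gamma> z (\<pi> 0 z) (0::real^'p)) + 0
      \<le> infinite_cost (linear_plant A B G) (stage_cost Q R \<gamma>) \<pi> (\<lambda>_. 0) z"
    unfolding infinite_cost_unfold[of _ _ \<pi>] by (intro add_left_mono cost_nonneg)
  also have "\<dots> \<le> worst_case_cost (linear_plant A B G) (stage_cost Q R \<gamma>) W \<pi> z"
    unfolding worst_case_cost_def using W by (intro SUP_upper) simp
  moreover have "1/2 * (z \<bullet> (Q *v z)) \<le> stage_cost Q R \<gamma> z (\<pi> 0 z) (0::real^'p)"
    using pos_def_nonneg[OF R] by (simp add: stage_cost_def)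
  ultimately show ?thesis by (simp add: order_trans[rotated])
qed

text \<open>The disturbance follows the saddle trajectory \<open>Ac\<^sup>n x\<close> for n steps and is zero afterwards.  From then
on the actual state z costs at least \<open>1/2 z'Qz\<close>, which beats the tangent at \<open>Ac\<^sup>n x\<close> up to
a multiple of \<open>|P Ac\<^sup>n x|\<^sup>2\<close> by Young's inequality, however large z is.  Stability of Ac makes
this error disappear as n grows.\<close>

lemma tangent_le_worst_case_cost:
  fixes A :: "real^'n^'n" and B :: "real^'m^'n" and G :: "real^'p^'n"
  assumes P: "pos_def P" and Q: "pos_def Q" and R: "pos_def R" and W: "0 \<in> W"
    and riccati: "hinf_riccati A B G Q R \<gamma> P"
  defines "Ku \<equiv> control_gain A B G R \<gamma> P" and "Kw \<equiv> disturbance_gain A B G R \<gamma> P"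
  assumes stable: "stable_matrix (A + B ** Ku + G ** Kw)"
    and S: "\<And>y. y \<in> S \<Longrightarrow> linear_plant A B G y (Ku *v y) (Kw *v y) \<in> S"
    and Kw: "\<And>y. y \<in> S \<Longrightarrow> Kw *v y \<in> W" and x: "x \<in> S"
  shows "ereal (tangent P x z) \<le> worst_case_cost (linear_plant A B G) (stage_cost Q R \<gamma>) W \<pi> z"
proof -
  let ?Ac = "A + B ** Ku + G ** Kw"
  obtain q where q: "0 < q" "\<And>x. q * (norm x)\<^sup>2 \<le> x \<bullet> (Q *v x)" using pos_def_coercive[OF Q] by metis
  \<comment> \<open>Young's inequality: \<open>|Py||z| \<le> q/2 |z|\<^sup>2 + |Py|\<^sup>2/(2q)\<close>, the first term being paid by \<open>1/2 z'Qz\<close>.\<close>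
  define e where "e y = (norm (P *v y))\<^sup>2 / (2 * q)" for y
  have closed_loop: "linear_plant A B G y (Ku *v y) (Kw *v y) = ?Ac *v y" for y
    by (simp add: linear_plant_def matrix_vector_mult_add_rdistrib matrix_vector_mul_assoc)
  have base: "ereal (tangent P y z - e y)
      \<le> worst_case_cost (linear_plant A B G) (stage_cost Q R \<gamma>) W \<pi> z" for y z \<pi>
  proof -
    let ?a = "norm (P *v y)" and ?b = "norm z"
    have "y \<bullet> (P *v z) \<le> ?a * ?b"
      using pos_def_sym[OF P, of y z] norm_cauchy_schwarz[of z "P *v y"] by (simp add: mult.commute)
    moreover have "?a * ?b \<le> q / 2 * ?b\<^sup>2 + e y"
    proof -
      have "0 \<le> (q * ?b - ?a)\<^sup>2 / (2 * q)" using q by simp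
      also have "\<dots> = q / 2 * ?b\<^sup>2 + e y - ?a * ?b"
        using q unfolding e_def by (simp add: field_simps power2_eq_square)
      finally show ?thesis by simp
    qed
    ultimately have "tangent P y z - e y \<le> 1/2 * (z \<bullet> (Q *v z))"
      using q(2)[of z] pos_def_nonneg[OF P, of y] unfolding tangent_def by linarith
    then show ?thesis
      using worst_case_cost_ge_quadratic[OF Q R W, of z A B G \<gamma> \<pi>] by (simp add: order_trans[rotated])
  qed
  have "ereal (tangent P x z - e (((*v) ?Ac ^^ n) x))
      \<le> worst_case_cost (linear_plant A B G) (stage_cost Q R \<gamma>) W \<pi> z" for n
  proof (rule worst_case_cost_ge_tangent[where S = S and k = "\<lambda>y. Kw *v y"])
    show "tangent P y z \<le> stage_cost Q R \<gamma> z u (Kw *v y)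
        + tangent P (?Ac *v y) (linear_plant A B G z u (Kw *v y))" for y z u
      using riccati_saddle_control[OF P Q R riccati, of z u y] pos_def_nonneg[OF Q, of "z - y"]
        pos_def_nonneg[OF R, of "u - Ku *v y"]
      by (simp add: Ku_def[symmetric] Kw_def[symmetric] closed_loop)
    show "?Ac *v y \<in> S" if "y \<in> S" for y
      using S[OF that] by (simp only: closed_loop)
  qed (use Kw base x in auto)
  then have "\<exists>N. \<forall>n\<ge>N. ereal (tangent P x z - e (((*v) ?Ac ^^ n) x))
      \<le> worst_case_cost (linear_plant A B G) (stage_cost Q R \<gamma>) W \<pi> z"
    by blast
  moreover have "(\<lambda>n. ereal (tangent P x z - e (((*v) ?Ac ^^ n) x))) \<longlonglongrightarrow> ereal (tangent P x z)"
  proof -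
    have "(\<lambda>n. norm (P *v (((*v) ?Ac ^^ n) x))) \<longlonglongrightarrow> norm (P *v 0)"
      by (intro tendsto_norm bounded_linear.tendsto[OF matrix_vector_mul_bounded_linear]
          stable_powers_tendsto_0 stable)
    then have "(\<lambda>n. tangent P x z - e (((*v) ?Ac ^^ n) x)) \<longlonglongrightarrow> tangent P x z - (norm (P *v 0))\<^sup>2 / (2 * q)"
      unfolding e_def
      by (intro tendsto_diff tendsto_divide tendsto_power tendsto_const) (use q in auto)
    then show ?thesis by simp
  qed
  ultimately show ?thesis by (rule LIMSEQ_le_const2[rotated])
qed

theorem theorem6:
  fixes A :: "real^'n^'n" and B :: "real^'m^'n" and G :: "real^'p^'n" and C :: "real^'n^'q"
    and Q :: "real^'n^'n" and R :: "real^'m^'m" and \<gamma> :: real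
    and U :: "(real^'m) set" and W :: "(real^'p) set"
    and f :: "real^'n \<Rightarrow> real^'m \<Rightarrow> real^'p \<Rightarrow> real^'n"
    and l :: "real^'n \<Rightarrow> real^'m \<Rightarrow> real^'p \<Rightarrow> real"
    and Pf :: "real^'n^'n" and Ku :: "real^'n^'m" and Kw :: "real^'n^'p"
    and Vf :: "real^'n \<Rightarrow> real" and Xf :: "(real^'n) set"
    and X :: "nat \<Rightarrow> (real^'n) set"
    and \<kappa>_inf :: "real^'n \<Rightarrow> real^'m"
  assumes f_def: "f = linear_plant A B G"
    and l_def: "l = stage_cost Q R \<gamma>"
    and "pos_def Q" and "pos_def R"
    and "polytope U" and "0 \<in> interior U"
    and "polytope W" and "0 \<in> interior W"
    and "stabilizable A B"
    and "Q = transpose C ** C"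
    and "\<forall>z. cmod z = 1 \<longrightarrow> \<not> system_zero C A B z"
    and "pos_def Pf" and "hinf_riccati A B G Q R \<gamma> Pf"
    and Ku_def: "Ku = control_gain A B G R \<gamma> Pf"
    and Kw_def: "Kw = disturbance_gain A B G R \<gamma> Pf"
    and "stable_matrix (A + B ** Ku)"
    and "stable_matrix (A + B ** Ku + G ** Kw)"
    and Vf_def: "Vf = (\<lambda>x. 1/2 * (x \<bullet> (Pf *v x)))"
    and "polytope Xf" and "0 \<in> interior Xf"
    and "\<forall>x\<in>Xf. f x (Ku *v x) ` W \<subseteq> Xf"
    and "(\<lambda>x. Ku *v x) ` Xf \<subseteq> U"
    and "(\<lambda>x. Kw *v x) ` Xf \<subseteq> W"
    and X_def: "X = domain_set f l U W Vf Xf"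
    and "optimal_law f l U W \<kappa>_inf"
  shows "((\<forall>j. robust_control_invariant f U W (X j)) \<and> (\<forall>j. X j \<subseteq> X (Suc j)))
    \<and> (\<forall>N. finite_time_attractive f \<kappa>_inf W Xf N (X N))
    \<and> (\<forall>N. \<forall>j\<le>N. Xf \<subseteq> interior (X j) \<longrightarrow> robustly_stable f \<kappa>_inf W Xf)"
proof -
  note Q = \<open>pos_def Q\<close> and R = \<open>pos_def R\<close> and P = \<open>pos_def Pf\<close>
    and riccati = \<open>hinf_riccati A B G Q R \<gamma> Pf\<close> and opt = \<open>optimal_law f l U W \<kappa>_inf\<close>
  have zero: "0 \<in> U" "0 \<in> W" "0 \<in> Xf"
    using \<open>0 \<in> interior U\<close> \<open>0 \<in> interior W\<close> \<open>0 \<in> interior Xf\<close> interior_subset by blast+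
  have Ku_in: "Ku *v x \<in> U" and Kw_in: "Kw *v x \<in> W" if "x \<in> Xf" for x
    using that \<open>(\<lambda>x. Ku *v x) ` Xf \<subseteq> U\<close> \<open>(\<lambda>x. Kw *v x) ` Xf \<subseteq> W\<close> by auto
  have invariant: "f x (Ku *v x) w \<in> Xf" if "x \<in> Xf" "w \<in> W" for x w
    using that \<open>\<forall>x\<in>Xf. f x (Ku *v x) ` W \<subseteq> Xf\<close> by blast
  have J: "infinite_value f l U W x = worst_case_cost f l W (\<lambda>_. \<kappa>_inf) x" for x
    using opt by (simp add: optimal_law_def)
  interpret convex_game f l U W "\<lambda>d. 1/2 * (d \<bullet> (R *v d))"
    unfolding f_def l_def using Q R \<open>polytope U\<close> \<open>polytope W\<close> zero
    by (intro linear_quadratic_convex_game) auto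
  have upper: "l x (Ku *v x) w + Vf (f x (Ku *v x) w) \<le> Vf x" for x w
    unfolding f_def l_def Vf_def Ku_def by (rule riccati_saddle_disturbance[OF P Q R riccati])
  interpret terminal_game f l U W "\<lambda>d. 1/2 * (d \<bullet> (R *v d))" Vf "tangent Pf" "\<lambda>x. Ku *v x"
    "\<lambda>x. Kw *v x" Xf
  proof
    show "convex_on UNIV Vf" unfolding Vf_def by (rule convex_quadratic[OF P])
    show "tangent Pf x x = Vf x" for x by (simp add: tangent_def Vf_def)
    show "tangent Pf x z \<le> Vf z" for x z
      unfolding Vf_def tangent_remainder[OF P, of z x] using pos_def_nonneg[OF P] by simp
    show "\<forall>\<^sub>F t in at_right 0. Vf (linepath x z t) \<le> (1 - t) * Vf x + t * (tangent Pf x z + e)"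
      if "0 < e" for e x z
      unfolding Vf_def using quadratic_secant[OF P that] .
    show "tangent Pf x z + 1/2 * ((u - Ku *v x) \<bullet> (R *v (u - Ku *v x)))
        \<le> l z u (Kw *v x) + tangent Pf (f x (Ku *v x) (Kw *v x)) (f z u (Kw *v x))" for x z u
      unfolding f_def l_def Ku_def Kw_def riccati_saddle_control[OF P Q R riccati]
      using pos_def_nonneg[OF Q, of "z - x"] by simp
    show "l x (Ku *v x) w + Vf (f x (Ku *v x) w) \<le> Vf x" for x w by (rule upper)
    show "compact Xf" using \<open>polytope Xf\<close> by (rule polytope_imp_compact)
    show "Xf \<noteq> {}" using zero by auto
  qed (use Ku_in Kw_in invariant in auto)
  interpret optimal_closed_loop f l U W "\<lambda>d. 1/2 * (d \<bullet> (R *v d))" Vf "tangent Pf" "\<lambda>x. Ku *v x"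
    "\<lambda>x. Kw *v x" Xf "infinite_value f l U W" \<kappa>_inf
  proof
    show "\<kappa>_inf x \<in> U" for x using opt by (simp add: optimal_law_def)
    show "ereal (l x (\<kappa>_inf x) w) + infinite_value f l U W (f x (\<kappa>_inf x) w)
        \<le> infinite_value f l U W x" if "w \<in> W" for x w
      using opt that by (rule infinite_value_ge_one_step)
    show "infinite_value f l U W x \<le> ereal c" if "u \<in> U"
      "\<And>w. w \<in> W \<Longrightarrow> ereal (l x u w) + infinite_value f l U W (f x u w) \<le> ereal c" for u x c
      using opt that by (rule infinite_value_le_one_step)
    show "ereal (tangent Pf x z) \<le> infinite_value f l U W z" if "x \<in> Xf" for x z
      unfolding J unfolding f_def l_def
      by (rule tangent_le_worst_case_cost[OF P Q R zero(2) riccati])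
         (use \<open>stable_matrix (A + B ** Ku + G ** Kw)\<close> that Kw_in saddle_point_in
           in \<open>simp_all add: Ku_def Kw_def f_def\<close>)
    show "infinite_value f l U W x \<le> ereal (Vf x)" if "x \<in> Xf" for x
      by (rule infinite_value_le_storage[where S = Xf and k = "\<lambda>x. Ku *v x"])
         (use invariant Ku_in upper that in \<open>auto simp: Vf_def pos_def_nonneg[OF P]\<close>)
  qed
  show ?thesis
    unfolding X_def using domain_set_invariant domain_set_mono attractive stable by blast
qed

end
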